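(* Let $x_j\in\mathbb{R}^2$, let $Y\subset\mathbb{R}^2$ be a compact set and define the disk $$D_j^{\max}=\{x\in\mathbb{R}^2 \mid |x-x_j|\le \max_{y\in Y}|y-x_j|\}.$$ Let $X\subset\mathbb{R}^2\setminus D_j^{\max}$ and $K\subset\mathbb{C}\setminus(-\infty,0]$ be compact sets. For $x\in X$ put $$a_x:=\frac{\max_{y\in Y}|y-x_j|}{|x-x_j|}.$$ Then there exist constants $C_1,C_2>0$, which may depend on $X$, $Y$, $K$ (and the fixed point $x_j$), such that for every integer $M\ge 2$, every $(x,k)\in X\times K$ and every $y\in Y$ (with any unit vector $\nu(y)$), the monopole truncation error $R_{j,M}(x;k)$ and the dipole truncation error $R'_{j,M}(x;k)$ satisfy $$R_{j,M}(x;k)\le C_1\Big(-\ln(1-a_x)-\sum_{m=1}^{M}\frac{a_x^m}{m}\Big),\qquad R'_{j,M}(x;k)\le C_2\,\frac{a_x^{M+1}}{1-a_x}.$$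
   Context: $|\cdot|$ is the Euclidean norm on $\mathbb{R}^2$ (and the modulus on $\mathbb{C}$). $J_m$ is the Bessel function of the first kind of order $m$ and $H^{(1)}_m$ the Hankel function of the first kind of order $m$ (principal branch, with cut along $(-\infty,0]$). For $x\in\mathbb{R}^2\setminus\{0\}$, $\arg x$ is the counter-clockwise angle of $x$ relative to $(1,0)$. The Green function of the 2D Helmholtz equation with wavenumber $k\in\mathbb{C}\setminus(-\infty,0]$ is $$G(x-y;k)=\frac{\mathrm{i}}{4}H^{(1)}_0(k|x-y|).$$ For a source at $y$, a new source location $x_j$ and an integer $M$, the truncated Graf expansion is $$G_{j,M}(x-y;k)=\frac{\mathrm{i}}{4}\sum_{m=-M}^{M}H^{(1)}_m(k|x-x_j|)\,J_m(k|y-x_j|)\,e^{\mathrm{i}m\theta},\qquad \theta=\arg(x-x_j)-\arg(y-x_j).$$ As a function of $y$, each term $J_m(k|y-x_j|)e^{-\mathrm{i}m\arg(y-x_j)}$ is understood to be extended smoothly to $y=x_j$. The truncation errors (which also depend on $y$) are $$R_{j,M}(x;k)=|G(x-y;k)-G_{j,M}(x-y;k)|,\qquad R'_{j,M}(x;k)=\Big|\frac{\partial}{\partial\nu(y)}\big[G(x-y;k)-G_{j,M}(x-y;k)\big]\Big|,$$ where $\partial/\partial\nu(y)$ is the directional derivative with respect to $y$ in the direction of a unit vector $\nu(y)$ (the dipole orientation). *)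

theory Defs
  imports "HOL-Analysis.Analysis"
begin

text \<open>
  Bessel functions of integer order. For \<open>n \<ge> 0\<close> these are the ascending series DLMF 10.2.2
  (first kind) and DLMF 10.8.1 (second kind); the orders \<open>-n\<close> are given by
  \<open>J\<^sub>-\<^sub>n = (-1)\<^sup>n J\<^sub>n\<close> and \<open>Y\<^sub>-\<^sub>n = (-1)\<^sup>n Y\<^sub>n\<close> (DLMF 10.4.1). Since \<^const>\<open>Ln\<close> is the principal
  logarithm, \<open>Y\<^sub>n\<close> and the Hankel function are the principal branches with cut along the
  nonpositive reals.
\<close>

definition bessel_J_nat :: "nat \<Rightarrow> complex \<Rightarrow> complex" where
  "bessel_J_nat n z =
     (z / 2) ^ n * (\<Sum>s. (- (z\<^sup>2 / 4)) ^ s / (fact s * fact (n + s)))"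

definition bessel_Y_nat :: "nat \<Rightarrow> complex \<Rightarrow> complex" where
  "bessel_Y_nat n z =
     - (1 / (of_real pi * (z / 2) ^ n)) * (\<Sum>s<n. fact (n - s - 1) / fact s * (z\<^sup>2 / 4) ^ s)
     + (2 / of_real pi) * Ln (z / 2) * bessel_J_nat n z
     - ((z / 2) ^ n / of_real pi) *
         (\<Sum>s. (Digamma (of_nat (s + 1)) + Digamma (of_nat (n + s + 1)))
               * (- (z\<^sup>2 / 4)) ^ s / (fact s * fact (n + s)))"

definition bessel_J :: "int \<Rightarrow> complex \<Rightarrow> complex" where
  "bessel_J m z = (if 0 \<le> m then 1 else (-1) ^ nat \<bar>m\<bar>) * bessel_J_nat (nat \<bar>m\<bar>) z"

definition bessel_Y :: "int \<Rightarrow> complex \<Rightarrow> complex" where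
  "bessel_Y m z = (if 0 \<le> m then 1 else (-1) ^ nat \<bar>m\<bar>) * bessel_Y_nat (nat \<bar>m\<bar>) z"

definition hankel1 :: "int \<Rightarrow> complex \<Rightarrow> complex" where
  "hankel1 m z = bessel_J m z + \<i> * bessel_Y m z"

definition angle2 :: "real^2 \<Rightarrow> real" where
  "angle2 x = Arg2pi (Complex (x $ 1) (x $ 2))"

definition green :: "complex \<Rightarrow> real^2 \<Rightarrow> complex" where
  "green k v = \<i> / 4 * hankel1 0 (k * of_real (norm v))"

text \<open>
  At \<open>y = x\<^sub>j\<close> the angle of \<open>0\<close> is a dummy value. It is irrelevant: there \<open>J\<^sub>m\<close> vanishes for
  \<open>m \<noteq> 0\<close>, and for \<open>m = 0\<close> the exponential is \<open>1\<close>. Hence, as a function of \<open>y\<close>, every summand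
  already takes the value of its smooth extension at \<open>x\<^sub>j\<close>.
\<close>

definition graf_trunc :: "complex \<Rightarrow> nat \<Rightarrow> real^2 \<Rightarrow> real^2 \<Rightarrow> real^2 \<Rightarrow> complex" where
  "graf_trunc k M xj x y =
     \<i> / 4 * (\<Sum>m = - int M..int M.
        hankel1 m (k * of_real (norm (x - xj))) * bessel_J m (k * of_real (norm (y - xj)))
        * exp (\<i> * of_int m * of_real (angle2 (x - xj) - angle2 (y - xj))))"

definition directional_derivative ::
  "('a::real_normed_vector \<Rightarrow> 'b::real_normed_vector) \<Rightarrow> 'a \<Rightarrow> 'a \<Rightarrow> 'b" where
  "directional_derivative f v y = vector_derivative (\<lambda>t. f (y + t *\<^sub>R v)) (at 0)"

definition monopole_error :: "complex \<Rightarrow> nat \<Rightarrow> real^2 \<Rightarrow> real^2 \<Rightarrow> real^2 \<Rightarrow> real" where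
  "monopole_error k M xj x y = cmod (green k (x - y) - graf_trunc k M xj x y)"

definition dipole_error ::
  "complex \<Rightarrow> nat \<Rightarrow> real^2 \<Rightarrow> real^2 \<Rightarrow> real^2 \<Rightarrow> real^2 \<Rightarrow> real" where
  "dipole_error k M xj x y \<nu> =
     cmod (directional_derivative (\<lambda>y'. green k (x - y') - graf_trunc k M xj x y') \<nu> y)"

definition max_dist :: "real^2 \<Rightarrow> (real^2) set \<Rightarrow> real" where
  "max_dist xj Y = (SUP y\<in>Y. norm (y - xj))"

text \<open>For nonempty compact \<open>Y\<close> the supremum is the maximum.\<close>

lemma max_dist_is_max:
  assumes "compact Y" "Y \<noteq> {}"
  shows "\<exists>y\<in>Y. norm (y - xj) = max_dist xj Y"
    and "\<forall>y\<in>Y. norm (y - xj) \<le> max_dist xj Y"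
proof -
  have "continuous_on Y (\<lambda>y. norm (y - xj))"
    by (intro continuous_intros)
  then obtain y0 where y0: "y0 \<in> Y" "\<forall>y\<in>Y. norm (y - xj) \<le> norm (y0 - xj)"
    using continuous_attains_sup[OF assms] by blast
  then have "max_dist xj Y = norm (y0 - xj)"
    unfolding max_dist_def by (intro cSup_eq_maximum) auto
  with y0 show "\<exists>y\<in>Y. norm (y - xj) = max_dist xj Y"
    and "\<forall>y\<in>Y. norm (y - xj) \<le> max_dist xj Y"
    by auto
qed

definition D_max :: "real^2 \<Rightarrow> (real^2) set \<Rightarrow> (real^2) set" where
  "D_max xj Y = {x. norm (x - xj) \<le> max_dist xj Y}"

definition dist_ratio :: "real^2 \<Rightarrow> (real^2) set \<Rightarrow> real^2 \<Rightarrow> real" where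
  "dist_ratio xj Y x = max_dist xj Y / norm (x - xj)"

end

theory Submission
  imports Defs "HOL-Complex_Analysis.Cauchy_Integral_Formula"
begin

text \<open>
  The error is the tail of a convergent series, so two things are needed: Graf's addition theorem
  for the Hankel function of order zero, and bounds on its terms and on their derivatives in the
  source point.

  For the addition theorem, write a point of the plane in the two complex variables
  \<open>A = z e\<^sup>i\<^sup>\<phi>\<close> and \<open>B = z e\<^sup>-\<^sup>i\<^sup>\<phi>\<close>, so that \<open>A B = z\<^sup>2\<close>. Every Bessel or Hankel function times
  \<open>e\<^sup>i\<^sup>m\<^sup>\<phi>\<close> is then analytic in \<open>(A, B)\<close> apart from one logarithm and the poles at \<open>A = 0\<close> and
  \<open>B = 0\<close>, and the classical recurrences become ladder relations: \<open>\<partial>/\<partial>A\<close> lowers the order by one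
  and contributes the factor \<open>1/2\<close>, \<open>\<partial>/\<partial>B\<close> raises it by one and contributes \<open>-1/2\<close>
  (\<open>has_field_derivative_polar_hankel\<close>). These are checked on the defining power series, including
  the digamma-weighted one. Translating the observation point from \<open>(u, u)\<close> to \<open>(u - a, u - b)\<close>
  is therefore a Taylor expansion along a complex segment whose coefficients are known Hankel
  values (\<open>graf_taylor\<close>). The segment avoids the singularities because \<open>|a|, |b| < |u|\<close>. Summing
  the resulting double series along diagonals instead of antidiagonals collects, for each
  order \<open>m\<close>, exactly the power series of \<open>J\<^sub>m\<close>; this is \<open>graf_addition\<close>. Absolute
  convergence of the double series, which allows the rearrangement, comes from the Hankel bound
  below.

  In the application \<open>u = k |x - x\<^sub>j|\<close>, while \<open>b\<close> and \<open>a\<close> are \<open>k\<close> times the complex coordinate of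
  \<open>y - x\<^sub>j\<close> and its conjugate, rotated so that \<open>x - x\<^sub>j\<close> has angle zero. The Green function at the
  source \<open>y\<close> is the value of the translated Hankel function, and the logarithms match because
  \<open>Ln (1 - \<zeta>) + Ln (1 - cnj \<zeta>)\<close> is the real number \<open>2 ln |1 - \<zeta>|\<close> (\<open>green_eq\<close>).

  For the bounds, the singular part of the Hankel function dominates: on a bounded set of arguments with
  bounded logarithm, \<open>|H\<^sub>m(u)| \<le> C (m - 1)! (2 / |u|)\<^sup>m\<close> (\<open>norm_hankel1_le\<close>), whereas \<open>|J\<^sub>m(v)|\<close>
  is at most a constant times \<open>|v/2|\<^sup>m / m!\<close>. The product is a constant times \<open>(|v|/|u|)\<^sup>m / m\<close>, and the
  tail of \<open>\<Sum> a\<^sup>m / m\<close> is the logarithmic remainder in the monopole estimate. A derivative in \<open>y\<close> costs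
  a factor \<open>m\<close> and one power of the distance of \<open>y\<close>, which turns the tail into a geometric series; the
  lost power is regained by dividing by the fixed number \<open>max |y - x\<^sub>j|\<close> if that is positive. If it
  is zero, every differentiated tail term vanishes at the centre because \<open>M \<ge> 2\<close>.
\<close>

section \<open>Bessel functions as series in the squared argument\<close>

text \<open>
  Dividing \<open>J\<^sub>n(z)\<close> by \<open>(z/2)\<^sup>n\<close>, and the digamma-weighted series of \<open>Y\<^sub>n(z)\<close> likewise, leaves an
  entire function of \<open>q = z\<^sup>2\<close>. Working with these reduced functions means that no square root of
  \<open>A B\<close> has to be chosen once the argument is split into two variables.
\<close>

definition J_coeff :: "nat \<Rightarrow> nat \<Rightarrow> complex" where
  "J_coeff n s = (- 1 / 4) ^ s / (fact s * fact (n + s))"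

definition Y_coeff :: "nat \<Rightarrow> nat \<Rightarrow> complex" where
  "Y_coeff n s = (Digamma (of_nat (s + 1)) + Digamma (of_nat (n + s + 1))) * J_coeff n s"

definition reduced_J :: "nat \<Rightarrow> complex \<Rightarrow> complex" where
  "reduced_J n q = (\<Sum>s. J_coeff n s * q ^ s)"

definition reduced_Y :: "nat \<Rightarrow> complex \<Rightarrow> complex" where
  "reduced_Y n q = (\<Sum>s. Y_coeff n s * q ^ s)"

lemma bessel_J_nat_eq: "bessel_J_nat n z = (z / 2) ^ n * reduced_J n (z * z)"
proof -
  have "(- (z\<^sup>2 / 4)) ^ s = (- 1 / 4) ^ s * (z * z) ^ s" for s
    unfolding power_mult_distrib[symmetric] by (simp add: power2_eq_square)
  then show ?thesis
    by (simp add: bessel_J_nat_def reduced_J_def J_coeff_def)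
qed

lemma norm_J_coeff: "norm (J_coeff n s) = inverse (fact (n + s)) * ((1/4) ^ s / fact s)"
proof -
  have "norm ((- 1 / 4) ^ s :: complex) = (1/4) ^ s"
    by (simp only: norm_power) simp
  then have "norm (J_coeff n s) = (1/4) ^ s / (fact s * fact (n + s))"
    by (simp only: J_coeff_def norm_divide norm_mult norm_fact)
  moreover have "c / (f * g) = inverse g * (c / f)" for c f g :: real
    by (simp add: divide_inverse mult_ac)
  ultimately show ?thesis by simp
qed

lemma norm_J_coeff_le: "norm (J_coeff n s) \<le> inverse (fact n) * ((1/4) ^ s / fact s)"
  unfolding norm_J_coeff by (intro mult_right_mono le_imp_inverse_le fact_mono) auto

text \<open>
  The value is a harmonic number minus Euler's constant. A linear bound is all that is
  needed, since the factorial in the denominator of each coefficient absorbs it.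
\<close>

lemma Digamma_bound: "norm (Digamma (of_nat (Suc s)) :: complex) \<le> real (Suc s)"
proof -
  have "(Digamma (of_nat (Suc s)) :: complex) = of_real (harm s - euler_mascheroni)"
    using Digamma_of_nat[of s, where 'a = complex]
    by (simp add: of_real_harm)
  moreover have "harm s \<le> real s"
    unfolding harm_def
    using sum_bounded_above[of "{1..s}" "\<lambda>k. inverse (of_nat k) :: real" 1]
    by (simp add: inverse_eq_divide)
  moreover have "(0::real) \<le> harm s" by (rule harm_nonneg)
  moreover have "0 < (euler_mascheroni :: real)" by (rule euler_mascheroni_pos)
  moreover have "euler_mascheroni < (1::real)"
    using euler_mascheroni_less_13_over_22 by linarith
  ultimately show ?thesis
    by (simp only: norm_of_real)
qed

lemma succ_le_two_fact: "real (Suc n) \<le> 2 * fact n"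
proof (cases n)
  case (Suc m)
  have "real n \<le> fact n" using fact_ge_self[of n] by (metis of_nat_fact of_nat_le_iff)
  moreover have "(1::real) \<le> fact n" by (rule fact_ge_1)
  ultimately show ?thesis by linarith
qed auto

lemma norm_Y_coeff_le: "norm (Y_coeff n s) \<le> 4 * ((1/4) ^ s / fact s)"
proof -
  have "norm (Digamma (of_nat (s + 1)) + Digamma (of_nat (n + s + 1)) :: complex)
        \<le> real (Suc s) + real (Suc (n + s))"
    using norm_triangle_mono[OF Digamma_bound[of s] Digamma_bound[of "n + s"]] by simp
  also have "\<dots> \<le> 4 * fact (n + s)"
    using succ_le_two_fact[of "n + s"] by simp
  finally have *: "norm (Digamma (of_nat (s + 1)) + Digamma (of_nat (n + s + 1)) :: complex)
     \<le> 4 * fact (n + s)" .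
  have "norm (Y_coeff n s) \<le> 4 * fact (n + s) * (inverse (fact (n + s)) * ((1/4) ^ s / fact s))"
    unfolding Y_coeff_def norm_mult norm_J_coeff using * by (intro mult_mono) auto
  also have "\<dots> = 4 * ((1/4) ^ s / fact s)"
  proof -
    have cancel: "4 * f * (inverse f * c) = 4 * c" if "f \<noteq> 0" for f c :: real
      using that by simp
    show ?thesis by (rule cancel) simp
  qed
  finally show ?thesis .
qed

lemma exp_sums_quarter: "(\<lambda>s. (1/4) ^ s / fact s * x ^ s) sums exp (x / 4 :: real)"
proof -
  have "(x / 4) ^ s /\<^sub>R fact s = (1/4) ^ s / fact s * x ^ s" for s
  proof -
    have "(x / 4) ^ s = (1/4) ^ s * x ^ s" using power_mult_distrib[of "1/4" x s] by simp
    then show ?thesis by (simp only: real_scaleR_def divide_inverse mult_ac)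
  qed
  then show ?thesis using exp_converges[of "x / 4"] by simp
qed

text \<open>
  Both reduced series are dominated, uniformly in the order, by the exponential series
  at \<open>|q|/4\<close>.
\<close>

lemma exp_majorised_series:
  fixes c :: "nat \<Rightarrow> complex"
  assumes "\<And>s. norm (c s) \<le> C * ((1/4) ^ s / fact s)"
  shows "summable (\<lambda>s. c s * q ^ s)"
    and "norm (\<Sum>s. c s * q ^ s) \<le> C * exp (norm q / 4)"
proof -
  have *: "(\<lambda>s. C * ((1/4) ^ s / fact s * norm q ^ s)) sums (C * exp (norm q / 4))"
    by (intro sums_mult exp_sums_quarter)
  have le: "norm (c s * q ^ s) \<le> C * ((1/4) ^ s / fact s * norm q ^ s)" for s
    using mult_right_mono[OF assms[of s], of "norm q ^ s"] by (simp add: norm_mult norm_power)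
  have 1: "summable (\<lambda>s. norm (c s * q ^ s))"
    by (rule summable_comparison_test'[OF sums_summable[OF *]]) (use le in auto)
  then show "summable (\<lambda>s. c s * q ^ s)" by (rule summable_norm_cancel)
  have "norm (\<Sum>s. c s * q ^ s) \<le> (\<Sum>s. norm (c s * q ^ s))"
    by (rule summable_norm[OF 1])
  also have "\<dots> \<le> C * exp (norm q / 4)"
    using suminf_le[OF le 1 sums_summable[OF *]] sums_unique[OF *] by simp
  finally show "norm (\<Sum>s. c s * q ^ s) \<le> C * exp (norm q / 4)" .
qed

lemmas reduced_J_summable = exp_majorised_series(1)[of "J_coeff n" "inverse (fact n)" for n, OF norm_J_coeff_le]
lemmas reduced_Y_summable = exp_majorised_series(1)[of "Y_coeff n" 4 for n, OF norm_Y_coeff_le]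

lemma norm_reduced_J_le: "norm (reduced_J n q) \<le> exp (norm q / 4) / fact n"
  using exp_majorised_series(2)[of "J_coeff n" "inverse (fact n)" q, OF norm_J_coeff_le]
  by (simp add: reduced_J_def field_simps)

lemma norm_reduced_Y_le: "norm (reduced_Y n q) \<le> 4 * exp (norm q / 4)"
  using exp_majorised_series(2)[of "Y_coeff n" 4 q, OF norm_Y_coeff_le] by (simp add: reduced_Y_def)

lemma J_coeff_Suc: "of_nat (Suc s) * J_coeff n (Suc s) = - J_coeff (Suc n) s / 4"
proof -
  have cancel: "x * (- 1 / 4 * c / (x * f * g)) = - (c / (f * g)) / (4 :: complex)"
    if "x \<noteq> 0" for x c f g
    using that by simp
  have "J_coeff n (Suc s) = (- 1 / 4 * (- 1 / 4) ^ s) / (of_nat (Suc s) * fact s * fact (Suc n + s))"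
    unfolding J_coeff_def power_Suc fact_Suc by (simp only: add_Suc add_Suc_right)
  then show ?thesis
    using cancel[of "of_nat (Suc s)" "(- 1 / 4) ^ s" "fact s" "fact (Suc n + s)"]
    by (simp only: J_coeff_def of_nat_eq_0_iff nat.distinct not_False_eq_True simp_thms)
qed

lemma J_coeff_shift: "of_nat (Suc n + s) * J_coeff (Suc n) s = J_coeff n s"
proof -
  have cancel: "x * (c / (f * (x * g))) = c / (f * g :: complex)" if "x \<noteq> 0" for x c f g
    using that by simp
  have "J_coeff (Suc n) s = (- 1 / 4) ^ s / (fact s * (of_nat (Suc n + s) * fact (n + s)))"
    unfolding J_coeff_def add_Suc fact_Suc ..
  then show ?thesis
    using cancel[of "of_nat (Suc n + s)" "(- 1 / 4) ^ s" "fact s" "fact (n + s)"]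
    by (simp only: J_coeff_def add_Suc of_nat_eq_0_iff nat.distinct not_False_eq_True simp_thms)
qed

lemma Digamma_Suc: "(Digamma (of_nat (Suc (Suc s))) :: complex) =
    Digamma (of_nat (Suc s)) + 1 / of_nat (Suc s)"
proof -
  have "of_nat (Suc s) \<noteq> (0 :: complex)" by (simp only: of_nat_eq_0_iff)
  from Digamma_plus1[OF this] show ?thesis by (simp add: add_ac)
qed

text \<open>
  The recurrence \<open>\<psi>(s + 2) = \<psi>(s + 1) + 1/(s + 1)\<close> produces a term with the coefficients of \<open>J\<^sub>n\<close>.
  In the Hankel function it cancels against the derivative of the logarithm.
\<close>

lemma Y_coeff_Suc: "of_nat (Suc s) * Y_coeff n (Suc s) = - Y_coeff (Suc n) s / 4 + J_coeff n (Suc s)"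
proof -
  define x where "x = (Digamma (of_nat (Suc s)) :: complex)"
  define y where "y = (Digamma (of_nat (Suc (Suc (n + s)))) :: complex)"
  have "of_nat (Suc s) * Y_coeff n (Suc s) = (x + 1 / of_nat (Suc s) + y) * (of_nat (Suc s) * J_coeff n (Suc s))"
    using Digamma_Suc[of s] by (simp add: Y_coeff_def x_def y_def)
  also have "\<dots> = (x + y) * (of_nat (Suc s) * J_coeff n (Suc s)) + J_coeff n (Suc s)"
    by (simp add: field_simps del: of_nat_Suc)
  also have "\<dots> = - Y_coeff (Suc n) s / 4 + J_coeff n (Suc s)"
    unfolding J_coeff_Suc by (simp add: Y_coeff_def x_def y_def)
  finally show ?thesis .
qed

lemma Y_coeff_shift: "of_nat (Suc n + s) * Y_coeff (Suc n) s = Y_coeff n s + J_coeff (Suc n) s"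
proof -
  define x where "x = (Digamma (of_nat (Suc s)) :: complex)"
  define y where "y = (Digamma (of_nat (Suc (n + s))) :: complex)"
  have "of_nat (Suc n + s) * Y_coeff (Suc n) s
      = (x + y + 1 / of_nat (Suc n + s)) * (of_nat (Suc n + s) * J_coeff (Suc n) s)"
    using Digamma_Suc[of "n+s"] by (simp add: Y_coeff_def x_def y_def)
  also have "\<dots> = (x + y) * (of_nat (Suc n + s) * J_coeff (Suc n) s) + J_coeff (Suc n) s"
    by (simp add: field_simps del: of_nat_Suc)
  also have "\<dots> = Y_coeff n s + J_coeff (Suc n) s"
    unfolding J_coeff_shift by (simp add: Y_coeff_def x_def y_def)
  finally show ?thesis .
qed

text \<open>
  This is \<open>(z\<^sup>-\<^sup>n J\<^sub>n)' = - z\<^sup>-\<^sup>n J\<^sub>n\<^sub>+\<^sub>1\<close> in the variable \<open>q\<close>; together with the next lemma, which is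
  \<open>(z\<^sup>n J\<^sub>n)' = z\<^sup>n J\<^sub>n\<^sub>-\<^sub>1\<close>, it carries the ladder relations.
\<close>

lemma has_field_derivative_reduced_J: "(reduced_J n has_field_derivative (- reduced_J (Suc n) q / 4)) (at q)"
proof -
  have "((\<lambda>x. \<Sum>s. J_coeff n s * x ^ s) has_field_derivative (\<Sum>s. diffs (J_coeff n) s * q ^ s)) (at q)"
    by (rule termdiffs_strong_converges_everywhere) (rule reduced_J_summable)
  moreover have "(\<Sum>s. diffs (J_coeff n) s * q ^ s) = - reduced_J (Suc n) q / 4"
  proof -
    have "(\<Sum>s. diffs (J_coeff n) s * q ^ s) = (\<Sum>s. (- 1 / 4) * (J_coeff (Suc n) s * q ^ s))"
      by (intro suminf_cong) (simp only: diffs_def J_coeff_Suc, simp)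
    then show ?thesis
      using suminf_mult[OF reduced_J_summable[of "Suc n" q], of "-1/4"] by (simp add: reduced_J_def)
  qed
  ultimately show ?thesis by (simp add: reduced_J_def [abs_def])
qed

lemma reduced_J_contiguous: "of_nat (Suc n) * reduced_J (Suc n) q - q * reduced_J (Suc (Suc n)) q / 4 = reduced_J n q"
proof -
  have "(\<lambda>s. J_coeff (Suc n) s * q ^ s) sums reduced_J (Suc n) q"
    unfolding reduced_J_def by (rule summable_sums[OF reduced_J_summable])
  from sums_mult[OF this, of "of_nat (Suc n)"]
  have 1: "(\<lambda>s. of_nat (Suc n) * (J_coeff (Suc n) s * q ^ s)) sums (of_nat (Suc n) * reduced_J (Suc n) q)" .
  have "(\<lambda>s. J_coeff (Suc (Suc n)) s * q ^ s) sums reduced_J (Suc (Suc n)) q"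
    unfolding reduced_J_def by (rule summable_sums[OF reduced_J_summable])
  from sums_mult[OF this, of "- q / 4"]
  have "(\<lambda>s. of_nat (Suc s) * J_coeff (Suc n) (Suc s) * q ^ Suc s) sums (- q / 4 * reduced_J (Suc (Suc n)) q)"
    unfolding J_coeff_Suc by (simp add: mult_ac)
  then have 2: "(\<lambda>s. of_nat s * J_coeff (Suc n) s * q ^ s) sums (- q / 4 * reduced_J (Suc (Suc n)) q)"
    using sums_Suc[of "\<lambda>s. of_nat s * J_coeff (Suc n) s * q ^ s"] by simp
  have "of_nat (Suc n) * (J_coeff (Suc n) s * q ^ s) + of_nat s * J_coeff (Suc n) s * q ^ s = J_coeff n s * q ^ s" for s
    unfolding J_coeff_shift[of n s, symmetric] by (simp add: algebra_simps)
  with sums_add[OF 1 2] have "(\<lambda>s. J_coeff n s * q ^ s) sums (of_nat (Suc n) * reduced_J (Suc n) q + - q / 4 * reduced_J (Suc (Suc n)) q)"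
    by simp
  then show ?thesis by (simp add: reduced_J_def sums_iff)
qed

text \<open>
  The closed form of this derivative has a removable singularity at \<open>q = 0\<close>, hence a name for the
  function itself and a formula for its product with \<open>q\<close>.
\<close>

definition reduced_Y_deriv :: "nat \<Rightarrow> complex \<Rightarrow> complex" where
  "reduced_Y_deriv n q = (\<Sum>s. diffs (Y_coeff n) s * q ^ s)"

lemma has_field_derivative_reduced_Y: "(reduced_Y n has_field_derivative reduced_Y_deriv n q) (at q)"
  unfolding reduced_Y_def[abs_def] reduced_Y_deriv_def
  by (rule termdiffs_strong_converges_everywhere) (rule reduced_Y_summable)

lemma reduced_Y_deriv_eq: "q * reduced_Y_deriv n q = - q * reduced_Y (Suc n) q / 4 + reduced_J n q - 1 / fact n"
proof -
  have "(\<lambda>s. J_coeff n s * q ^ s) sums reduced_J n q"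
    unfolding reduced_J_def by (rule summable_sums[OF reduced_J_summable])
  then have 1: "(\<lambda>s. J_coeff n (Suc s) * q ^ Suc s) sums (reduced_J n q - 1 / fact n)"
    by (subst sums_Suc_iff) (simp add: J_coeff_def)
  have "(\<lambda>s. Y_coeff (Suc n) s * q ^ s) sums reduced_Y (Suc n) q"
    unfolding reduced_Y_def by (rule summable_sums[OF reduced_Y_summable])
  from sums_mult[OF this, of "- q / 4"]
  have 2: "(\<lambda>s. - Y_coeff (Suc n) s / 4 * q ^ Suc s) sums (- q * reduced_Y (Suc n) q / 4)"
    by (simp add: mult_ac)
  have "(\<lambda>s. diffs (Y_coeff n) s * q ^ s) sums reduced_Y_deriv n q"
    unfolding reduced_Y_deriv_def by (intro summable_sums termdiff_converges_all reduced_Y_summable)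
  from sums_mult[OF this, of q]
  have 3: "(\<lambda>s. diffs (Y_coeff n) s * q ^ Suc s) sums (q * reduced_Y_deriv n q)"
    by (simp add: mult_ac)
  have "diffs (Y_coeff n) s * q ^ Suc s = - Y_coeff (Suc n) s / 4 * q ^ Suc s + J_coeff n (Suc s) * q ^ Suc s" for s
    by (simp only: diffs_def Y_coeff_Suc ring_distribs)
  with sums_add[OF 2 1] have "(\<lambda>s. diffs (Y_coeff n) s * q ^ Suc s) sums
      (- q * reduced_Y (Suc n) q / 4 + (reduced_J n q - 1 / fact n))"
    by simp
  from sums_unique2[OF 3 this] show ?thesis by simp
qed

lemma reduced_Y_contiguous: "of_nat (Suc n) * reduced_Y (Suc n) q + q * reduced_Y_deriv (Suc n) q = reduced_Y n q + reduced_J (Suc n) q"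
proof -
  have "(\<lambda>s. Y_coeff (Suc n) s * q ^ s) sums reduced_Y (Suc n) q"
    unfolding reduced_Y_def by (rule summable_sums[OF reduced_Y_summable])
  from sums_mult[OF this, of "of_nat (Suc n)"]
  have 1: "(\<lambda>s. of_nat (Suc n) * (Y_coeff (Suc n) s * q ^ s)) sums (of_nat (Suc n) * reduced_Y (Suc n) q)" .
  have "(\<lambda>s. diffs (Y_coeff (Suc n)) s * q ^ s) sums reduced_Y_deriv (Suc n) q"
    unfolding reduced_Y_deriv_def by (intro summable_sums termdiff_converges_all reduced_Y_summable)
  from sums_mult[OF this, of q]
  have "(\<lambda>s. of_nat (Suc s) * Y_coeff (Suc n) (Suc s) * q ^ Suc s) sums (q * reduced_Y_deriv (Suc n) q)"
    by (simp add: mult_ac diffs_def)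
  then have 2: "(\<lambda>s. of_nat s * Y_coeff (Suc n) s * q ^ s) sums (q * reduced_Y_deriv (Suc n) q)"
    using sums_Suc[of "\<lambda>s. of_nat s * Y_coeff (Suc n) s * q ^ s"] by simp
  have "of_nat (Suc n) * (Y_coeff (Suc n) s * q ^ s) + of_nat s * Y_coeff (Suc n) s * q ^ s
      = of_nat (Suc n + s) * Y_coeff (Suc n) s * q ^ s" for s
    by (simp add: algebra_simps)
  then have e: "of_nat (Suc n) * (Y_coeff (Suc n) s * q ^ s) + of_nat s * Y_coeff (Suc n) s * q ^ s
      = Y_coeff n s * q ^ s + J_coeff (Suc n) s * q ^ s" for s
    unfolding Y_coeff_shift by (simp only: ring_distribs)
  have "(\<lambda>s. Y_coeff n s * q ^ s) sums reduced_Y n q" "(\<lambda>s. J_coeff (Suc n) s * q ^ s) sums reduced_J (Suc n) q"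
    unfolding reduced_J_def reduced_Y_def by (intro summable_sums reduced_J_summable reduced_Y_summable)+
  from sums_add[OF this] sums_add[OF 1 2] show ?thesis
    unfolding e by (rule sums_unique2[symmetric])
qed

section \<open>Cylinder functions in two complex variables\<close>

text \<open>
  For \<open>A = z e\<^sup>i\<^sup>\<phi>\<close> and \<open>B = z e\<^sup>-\<^sup>i\<^sup>\<phi>\<close> the first of these is \<open>J\<^sub>n(z) e\<^sup>i\<^sup>n\<^sup>\<phi>\<close>. The next two are, up to the
  factor \<open>-1/\<pi>\<close>, the digamma series and the finite singular part of \<open>Y\<^sub>n(z) e\<^sup>i\<^sup>n\<^sup>\<phi>\<close>. The logarithm
  \<open>2 Ln (z/2)\<close> becomes the separate argument \<open>L\<close>, so that its branch can be continued along a path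
  independently of \<open>A\<close> and \<open>B\<close>. Negative orders exchange \<open>A\<close> and \<open>B\<close>, because
  \<open>H\<^sub>-\<^sub>n(z) e\<^sup>-\<^sup>i\<^sup>n\<^sup>\<phi> = (-1)\<^sup>n H\<^sub>n(z) e\<^sup>-\<^sup>i\<^sup>n\<^sup>\<phi>\<close>.
\<close>

definition polar_J :: "nat \<Rightarrow> complex \<Rightarrow> complex \<Rightarrow> complex" where
  "polar_J n A B = (A / 2) ^ n * reduced_J n (A * B)"

definition polar_Y :: "nat \<Rightarrow> complex \<Rightarrow> complex \<Rightarrow> complex" where
  "polar_Y n A B = (A / 2) ^ n * reduced_Y n (A * B)"

definition polar_pole :: "nat \<Rightarrow> complex \<Rightarrow> complex \<Rightarrow> complex" where
  "polar_pole n A B = (\<Sum>s<n. fact (n - s - 1) / fact s * (A / 2) ^ s / (B / 2) ^ (n - s))"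

definition polar_hankel_nat :: "nat \<Rightarrow> complex \<Rightarrow> complex \<Rightarrow> complex \<Rightarrow> complex" where
  "polar_hankel_nat n A B L =
     polar_J n A B + \<i> / of_real pi * (L * polar_J n A B - polar_pole n A B - polar_Y n A B)"

definition polar_hankel :: "int \<Rightarrow> complex \<Rightarrow> complex \<Rightarrow> complex \<Rightarrow> complex" where
  "polar_hankel m A B L =
     (if 0 \<le> m then polar_hankel_nat (nat m) A B L
      else (- 1) ^ nat (- m) * polar_hankel_nat (nat (- m)) B A L)"

lemma hankel1_eq_polar_hankel:
  assumes "z \<noteq> 0"
  shows "hankel1 m z = polar_hankel m z z (2 * Ln (z / 2))"
proof -
  have q: "(- (z\<^sup>2 / 4)) ^ s = (- 1 / 4) ^ s * (z * z) ^ s" for s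
    unfolding power_mult_distrib[symmetric] by (simp add: power2_eq_square)
  have J: "bessel_J_nat n z = polar_J n z z" for n
    unfolding bessel_J_nat_eq polar_J_def ..
  have pole: "1 / (z / 2) ^ n * (\<Sum>s<n. fact (n - s - 1) / fact s * (z\<^sup>2 / 4) ^ s) = polar_pole n z z" for n
    unfolding polar_pole_def sum_distrib_left
  proof (rule sum.cong[OF refl])
    fix s assume "s \<in> {..<n}"
    then have n: "n = (n - s) + s" by simp
    have 1: "(z / 2) ^ n = (z / 2) ^ (n - s) * (z / 2) ^ s"
      by (subst n) (rule power_add)
    have 2: "(z\<^sup>2 / 4) ^ s = (z / 2) ^ s * (z / 2) ^ s"
      unfolding power_mult_distrib[symmetric] by (simp add: power2_eq_square)
    have 3: "1 / (y * x) * (c * (x * x)) = c * x / y" if "x \<noteq> 0" for x y c :: complex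
      using that by simp
    show "1 / (z / 2) ^ n * (fact (n - s - 1) / fact s * (z\<^sup>2 / 4) ^ s)
        = fact (n - s - 1) / fact s * (z / 2) ^ s / (z / 2) ^ (n - s)"
      unfolding 1 2 by (rule 3) (use assms in simp)
  qed
  have Y: "bessel_Y_nat n z
      = 1 / of_real pi * (2 * Ln (z / 2) * polar_J n z z - polar_pole n z z - polar_Y n z z)" for n
  proof -
    have "bessel_Y_nat n z = 1 / of_real pi * (2 * Ln (z / 2) * polar_J n z z
        - 1 / (z / 2) ^ n * (\<Sum>s<n. fact (n - s - 1) / fact s * (z\<^sup>2 / 4) ^ s)
        - (z / 2) ^ n * (\<Sum>s. (Digamma (of_nat (s + 1)) + Digamma (of_nat (n + s + 1)))
               * (- (z\<^sup>2 / 4)) ^ s / (fact s * fact (n + s))))"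
    proof -
      have "- (1 / (p * w)) * S + (2 / p) * l * j - (w / p) * E
          = 1 / p * (2 * l * j - 1 / w * S - w * E)" for p w S l j E :: complex
        by (simp add: divide_inverse algebra_simps)
      then show ?thesis unfolding bessel_Y_nat_def J .
    qed
    then show ?thesis
      unfolding pole unfolding polar_Y_def reduced_Y_def Y_coeff_def J_coeff_def q
      by (simp add: mult.assoc)
  qed
  have "bessel_J_nat n z + \<i> * bessel_Y_nat n z = polar_hankel_nat n z z (2 * Ln (z / 2))" for n
    unfolding J Y polar_hankel_nat_def by simp
  moreover have "c * x + \<i> * (c * y) = c * (x + \<i> * y)" for c x y :: complex
    by (simp add: algebra_simps)
  ultimately show ?thesis
    unfolding hankel1_def bessel_J_def bessel_Y_def polar_hankel_def by (simp add: abs_if)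
qed

section \<open>Ladder relations along a curve\<close>

text \<open>
  Derivatives are taken along a one-parameter curve \<open>(A(e), B(e))\<close>: this replaces partial
  derivatives in two variables, and the coefficient of \<open>A'\<close> (of \<open>B'\<close>) in each formula is the
  partial derivative with respect to \<open>A\<close> (to \<open>B\<close>).
\<close>

context
  fixes A B :: "complex \<Rightarrow> complex" and A' B' e :: complex
  assumes dA: "(A has_field_derivative A') (at e)"
    and dB: "(B has_field_derivative B') (at e)"
begin

lemma has_field_derivative_product:
  "((\<lambda>e. A e * B e) has_field_derivative (A' * B e + B' * A e)) (at e)"
  using DERIV_mult[OF dA dB] .

lemma has_field_derivative_polar_J_0:
  "((\<lambda>e. polar_J 0 (A e) (B e)) has_field_derivative
      - (A' / 2) * polar_J 1 (B e) (A e) - B' / 2 * polar_J 1 (A e) (B e)) (at e)"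
proof -
  have "((\<lambda>e. reduced_J 0 (A e * B e)) has_field_derivative
      (- reduced_J 1 (A e * B e) / 4) * (A' * B e + B' * A e)) (at e)"
    using DERIV_chain2[OF has_field_derivative_reduced_J has_field_derivative_product, of 0] by simp
  then show ?thesis
    by (simp add: polar_J_def algebra_simps add_divide_distrib)
qed

lemma has_field_derivative_polar_J_Suc:
  "((\<lambda>e. polar_J (Suc n) (A e) (B e)) has_field_derivative
      A' / 2 * polar_J n (A e) (B e) - B' / 2 * polar_J (Suc (Suc n)) (A e) (B e)) (at e)"
proof -
  define q where "q = A e * B e"
  define X where "X = (A e / 2) ^ n"
  have "((\<lambda>e. (A e / 2) ^ Suc n) has_field_derivative of_nat (Suc n) * (A' / 2) * X) (at e)"
    using DERIV_power_Suc[OF DERIV_cdivide[OF dA, of 2], of n] by (simp add: X_def algebra_simps)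
  moreover have "((\<lambda>e. reduced_J (Suc n) (A e * B e)) has_field_derivative
      (- reduced_J (Suc (Suc n)) q / 4) * (A' * B e + B' * A e)) (at e)"
    unfolding q_def by (rule DERIV_chain2[OF has_field_derivative_reduced_J has_field_derivative_product])
  ultimately have "((\<lambda>e. polar_J (Suc n) (A e) (B e)) has_field_derivative
      of_nat (Suc n) * (A' / 2) * X * reduced_J (Suc n) q
      + (- reduced_J (Suc (Suc n)) q / 4) * (A' * B e + B' * A e) * (A e / 2 * X)) (at e)"
    unfolding polar_J_def using DERIV_mult by (fastforce simp: q_def X_def)
  moreover have "of_nat (Suc n) * (A' / 2) * X * reduced_J (Suc n) q
      + (- reduced_J (Suc (Suc n)) q / 4) * (A' * B e + B' * A e) * (A e / 2 * X)
      = A' / 2 * (X * (of_nat (Suc n) * reduced_J (Suc n) q - q * reduced_J (Suc (Suc n)) q / 4))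
      - B' / 2 * ((A e / 2) * (A e / 2) * X * reduced_J (Suc (Suc n)) q)"
    by (simp add: field_simps q_def)
  moreover have "(A e / 2) * (A e / 2) * X * reduced_J (Suc (Suc n)) q = polar_J (Suc (Suc n)) (A e) (B e)"
    by (simp add: polar_J_def X_def q_def)
  moreover have "X * reduced_J n q = polar_J n (A e) (B e)"
    by (simp add: polar_J_def X_def q_def)
  ultimately show ?thesis
    by (simp only: reduced_J_contiguous)
qed

text \<open>
  Apart from the ladder terms, terms with \<open>polar_J\<close> and pure powers appear. The former
  cancel the derivative \<open>A'/A + B'/B\<close> of the logarithm, the latter complete the singular
  part of the next order.
\<close>

lemma has_field_derivative_polar_Y_0:
  assumes "A e \<noteq> 0" "B e \<noteq> 0"
  shows "((\<lambda>e. polar_Y 0 (A e) (B e)) has_field_derivative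
      A' * (- polar_Y 1 (B e) (A e) / 2 + polar_J 0 (A e) (B e) / A e - 1 / A e)
    + B' * (- polar_Y 1 (A e) (B e) / 2 + polar_J 0 (A e) (B e) / B e - 1 / B e)) (at e)"
proof -
  define q where "q = A e * B e"
  have "((\<lambda>e. reduced_Y 0 (A e * B e)) has_field_derivative
      reduced_Y_deriv 0 q * (A' * B e + B' * A e)) (at e)"
    using DERIV_chain2[OF has_field_derivative_reduced_Y has_field_derivative_product, of 0]
    by (simp add: q_def)
  moreover have "reduced_Y_deriv 0 q * (A' * B e + B' * A e)
    = A' * ((q * reduced_Y_deriv 0 q) / A e) + B' * ((q * reduced_Y_deriv 0 q) / B e)"
    using assms by (simp add: q_def field_simps)
  moreover have "(q * reduced_Y_deriv 0 q) / A e = - polar_Y 1 (B e) (A e) / 2 + polar_J 0 (A e) (B e) / A e - 1 / A e"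
    unfolding reduced_Y_deriv_eq using assms
    by (simp add: polar_Y_def polar_J_def q_def mult.commute[of "B e"] diff_divide_distrib add_divide_distrib)
  moreover have "(q * reduced_Y_deriv 0 q) / B e = - polar_Y 1 (A e) (B e) / 2 + polar_J 0 (A e) (B e) / B e - 1 / B e"
    unfolding reduced_Y_deriv_eq using assms
    by (simp add: polar_Y_def polar_J_def q_def diff_divide_distrib add_divide_distrib)
  ultimately show ?thesis by (simp add: polar_Y_def)
qed

lemma has_field_derivative_polar_Y_Suc:
  assumes "A e \<noteq> 0" "B e \<noteq> 0"
  shows "((\<lambda>e. polar_Y (Suc n) (A e) (B e)) has_field_derivative
      A' * (polar_Y n (A e) (B e) / 2 + polar_J (Suc n) (A e) (B e) / A e)
    + B' * (- polar_Y (Suc (Suc n)) (A e) (B e) / 2 + polar_J (Suc n) (A e) (B e) / B e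
            - (A e / 2) ^ Suc n / fact (Suc n) / B e)) (at e)"
proof -
  define q where "q = A e * B e"
  define X where "X = (A e / 2) ^ n"
  have "((\<lambda>e. (A e / 2) ^ Suc n) has_field_derivative of_nat (Suc n) * (A' / 2) * X) (at e)"
    using DERIV_power_Suc[OF DERIV_cdivide[OF dA, of 2], of n] by (simp add: X_def algebra_simps)
  moreover have "((\<lambda>e. reduced_Y (Suc n) (A e * B e)) has_field_derivative
      reduced_Y_deriv (Suc n) q * (A' * B e + B' * A e)) (at e)"
    unfolding q_def by (rule DERIV_chain2[OF has_field_derivative_reduced_Y has_field_derivative_product])
  ultimately have deriv: "((\<lambda>e. polar_Y (Suc n) (A e) (B e)) has_field_derivative
      of_nat (Suc n) * (A' / 2) * X * reduced_Y (Suc n) q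
      + reduced_Y_deriv (Suc n) q * (A' * B e + B' * A e) * (A e / 2 * X)) (at e)"
    unfolding polar_Y_def using DERIV_mult by (fastforce simp: q_def X_def)
  have split: "of_nat (Suc n) * (A' / 2) * X * reduced_Y (Suc n) q
      + reduced_Y_deriv (Suc n) q * (A' * B e + B' * A e) * (A e / 2 * X)
      = A' / 2 * (X * (of_nat (Suc n) * reduced_Y (Suc n) q + q * reduced_Y_deriv (Suc n) q))
      + B' * (A e / 2 * X * (q * reduced_Y_deriv (Suc n) q) / B e)"
    using assms by (simp add: algebra_simps q_def)
  have partA: "A' / 2 * (X * (of_nat (Suc n) * reduced_Y (Suc n) q + q * reduced_Y_deriv (Suc n) q))
      = A' * (polar_Y n (A e) (B e) / 2 + polar_J (Suc n) (A e) (B e) / A e)"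
    unfolding reduced_Y_contiguous using assms
    by (simp add: polar_Y_def polar_J_def X_def q_def ring_distribs)
  have partB: "A e / 2 * X * (q * reduced_Y_deriv (Suc n) q) / B e
     = - polar_Y (Suc (Suc n)) (A e) (B e) / 2 + polar_J (Suc n) (A e) (B e) / B e
            - (A e / 2) ^ Suc n / fact (Suc n) / B e"
    unfolding reduced_Y_deriv_eq polar_Y_def polar_J_def power_Suc X_def[symmetric] q_def[symmetric]
    using assms by (simp add: q_def ring_distribs diff_divide_distrib add_divide_distrib)
  show ?thesis using deriv unfolding split partA partB .
qed

lemma polar_pole_term_deriv:
  assumes "B e \<noteq> 0"
  shows "((\<lambda>e. c * (A e / 2) ^ s / (B e / 2) ^ Suc k) has_field_derivative
      A' / 2 * (c * of_nat s * (A e / 2) ^ (s - 1) / (B e / 2) ^ Suc k)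
    - B' / 2 * (c * of_nat (Suc k) * (A e / 2) ^ s / (B e / 2) ^ Suc (Suc k))) (at e)"
proof -
  have 1: "((\<lambda>e. c * (A e / 2) ^ s) has_field_derivative c * (of_nat s * (A' / 2 * (A e / 2) ^ (s - Suc 0)))) (at e)"
    using DERIV_cmult[OF DERIV_power[OF DERIV_cdivide[OF dA, of 2], of s], of c] .
  have 2: "((\<lambda>e. (B e / 2) ^ Suc k) has_field_derivative (of_nat (Suc k) * (B' / 2 * (B e / 2) ^ k))) (at e)"
    using DERIV_power[OF DERIV_cdivide[OF dB, of 2], of "Suc k"] by simp
  have alg: "(c * (n * (A' / 2 * x)) * (b * y) - c * z * (m * (B' / 2 * y))) / (b * y * (b * y))
     = A' / 2 * (c * n * x / (b * y)) - B' / 2 * (c * m * z / (b * (b * y)))"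
    if "b \<noteq> 0" "y \<noteq> 0" for n x b y z m :: complex
    using that by (simp add: diff_divide_distrib mult_ac)
  have nz: "(B e / 2) ^ Suc k \<noteq> 0" "B e / 2 \<noteq> 0" "(B e / 2) ^ k \<noteq> 0" using assms by auto
  show ?thesis
    by (rule DERIV_cong[OF DERIV_divide[OF 1 2 nz(1)]])
      (simp only: power_Suc One_nat_def alg[OF nz(2,3)])
qed

text \<open>
  Lowering drops one summand. Raising would need a summand more than the derivative supplies,
  and this missing one is the pure power left over from the digamma series.
\<close>

lemma has_field_derivative_polar_pole:
  assumes "B e \<noteq> 0"
  shows "((\<lambda>e. polar_pole n (A e) (B e)) has_field_derivative
      A' / 2 * (if n = 0 then 0 else polar_pole (n - 1) (A e) (B e))
    - B' / 2 * (polar_pole (Suc n) (A e) (B e) - (A e / 2) ^ n / fact n / (B e / 2))) (at e)"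
proof -
  define x y where "x = A e / 2" and "y = B e / 2"
  have "((\<lambda>e. polar_pole n (A e) (B e)) has_field_derivative
     (\<Sum>s<n. A' / 2 * (fact (n - s - 1) / fact s * of_nat s * x ^ (s - 1) / y ^ (n - s))
       - B' / 2 * (fact (n - s - 1) / fact s * of_nat (n - s) * x ^ s / y ^ Suc (n - s)))) (at e)"
    unfolding polar_pole_def
  proof (rule DERIV_sum)
    fix s assume "s \<in> {..<n}"
    then obtain k where k: "n - s = Suc k" by (metis Suc_diff_Suc lessThan_iff)
    show "((\<lambda>e. fact (n - s - 1) / fact s * (A e / 2) ^ s / (B e / 2) ^ (n - s)) has_field_derivative
       A' / 2 * (fact (n - s - 1) / fact s * of_nat s * x ^ (s - 1) / y ^ (n - s))
       - B' / 2 * (fact (n - s - 1) / fact s * of_nat (n - s) * x ^ s / y ^ Suc (n - s))) (at e)"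
      unfolding k x_def y_def by (rule polar_pole_term_deriv[OF assms])
  qed
  also have "(\<Sum>s<n. A' / 2 * (fact (n - s - 1) / fact s * of_nat s * x ^ (s - 1) / y ^ (n - s))
       - B' / 2 * (fact (n - s - 1) / fact s * of_nat (n - s) * x ^ s / y ^ Suc (n - s)))
     = A' / 2 * (\<Sum>s<n. fact (n - s - 1) / fact s * of_nat s * x ^ (s - 1) / y ^ (n - s))
     - B' / 2 * (\<Sum>s<n. fact (n - s - 1) / fact s * of_nat (n - s) * x ^ s / y ^ Suc (n - s))"
    by (simp only: sum_subtractf sum_distrib_left)
  also have "(\<Sum>s<n. fact (n - s - 1) / fact s * of_nat s * x ^ (s - 1) / y ^ (n - s))
     = (if n = 0 then 0 else polar_pole (n - 1) (A e) (B e))"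
  proof (cases n)
    case (Suc m)
    have cancel: "c / (z * f) * z = c / f" if "z \<noteq> 0" for c z f :: complex using that by simp
    have c: "fact (Suc m - Suc s - 1) / fact (Suc s) * of_nat (Suc s) = (fact (m - s - 1) / fact s :: complex)" for s
      unfolding fact_Suc diff_Suc_Suc by (rule cancel) (simp only: of_nat_eq_0_iff)
    show ?thesis
      unfolding Suc sum.lessThan_Suc_shift polar_pole_def x_def[symmetric] y_def[symmetric] c
      by (simp only: diff_Suc_Suc diff_Suc_1 of_nat_0 mult_zero_right mult_zero_left div_0 add_0
        nat.distinct if_False)
  qed simp
  also have "(\<Sum>s<n. fact (n - s - 1) / fact s * of_nat (n - s) * x ^ s / y ^ Suc (n - s))
     = polar_pole (Suc n) (A e) (B e) - (A e / 2) ^ n / fact n / (B e / 2)"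
  proof -
    have "fact (n - s - 1) / fact s * of_nat (n - s) * x ^ s / y ^ Suc (n - s)
        = fact (Suc n - s - 1) / fact s * x ^ s / y ^ (Suc n - s)" if "s < n" for s
    proof -
      obtain k where k: "n - s = Suc k" using Suc_diff_Suc[OF \<open>s < n\<close>] by metis
      with that have k': "Suc n - s = Suc (Suc k)" by linarith
      have "f / g * m * X / Y = m * f / g * X / Y" for f g m X Y :: complex
        by (simp add: mult.commute)
      then show ?thesis
        unfolding k k' diff_Suc_1 fact_Suc[of k] .
    qed
    then have e: "(\<Sum>s<n. fact (n - s - 1) / fact s * of_nat (n - s) * x ^ s / y ^ Suc (n - s))
        = (\<Sum>s<n. fact (Suc n - s - 1) / fact s * x ^ s / y ^ (Suc n - s))"
      by (intro sum.cong refl) (simp only: lessThan_iff)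
    have "fact (Suc n - n - 1) / fact n * x ^ n / y ^ (Suc n - n) = x ^ n / fact n / y"
      by simp
    then show ?thesis
      unfolding polar_pole_def sum.lessThan_Suc x_def[symmetric] y_def[symmetric] e
      by (simp only: add_diff_cancel_right')
  qed
  finally show ?thesis .
qed

end

lemma has_field_derivative_polar_hankel_nat_0:
  fixes A B L :: "complex \<Rightarrow> complex"
  assumes dA: "(A has_field_derivative A') (at e)"
    and dB: "(B has_field_derivative B') (at e)"
    and dL: "(L has_field_derivative A' / A e + B' / B e) (at e)"
    and nz: "A e \<noteq> 0" "B e \<noteq> 0"
  shows "((\<lambda>e. polar_hankel_nat 0 (A e) (B e) (L e)) has_field_derivative
      - (A' / 2) * polar_hankel_nat 1 (B e) (A e) (L e)
      - B' / 2 * polar_hankel_nat 1 (A e) (B e) (L e)) (at e)"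
proof -
  define c where "c = \<i> / of_real pi"
  define J0 J1 J1' Y1 Y1' where "J0 = polar_J 0 (A e) (B e)" and "J1 = polar_J 1 (A e) (B e)"
    and "J1' = polar_J 1 (B e) (A e)" and "Y1 = polar_Y 1 (A e) (B e)" and "Y1' = polar_Y 1 (B e) (A e)"
  note dJ = has_field_derivative_polar_J_0[OF dA dB]
  note dT = has_field_derivative_polar_pole[OF dA dB nz(2), of 0]
  note dY = has_field_derivative_polar_Y_0[OF dA dB nz]
  have pole: "polar_pole (Suc 0) a b = 2 / b" "polar_pole 0 a b = 0" for a b :: complex
    by (simp_all add: polar_pole_def)
  define a b where "a = A' / A e" and "b = B' / B e"
  have 1: "A' * (- Y1' / 2 + J0 / A e - 1 / A e) = - (A' / 2 * Y1') + a * J0 - a"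
    by (simp add: a_def distrib_left right_diff_distrib)
  have 2: "B' * (- Y1 / 2 + J0 / B e - 1 / B e) = - (B' / 2 * Y1) + b * J0 - b"
    by (simp add: b_def distrib_left right_diff_distrib)
  have 3: "B' / 2 * (2 / B e - (A e / 2) ^ 0 / fact 0 / (B e / 2)) = 0"
    using nz by simp
  have 4: "A' / 2 * (J1' + c * (l * J1' - 2 / A e - Y1')) = A' / 2 * (J1' + c * (l * J1' - Y1')) - c * a"
      "B' / 2 * (J1 + c * (l * J1 - 2 / B e - Y1)) = B' / 2 * (J1 + c * (l * J1 - Y1)) - c * b" for l
    using nz by (simp_all add: a_def b_def algebra_simps)
  have "- (\<alpha> * J1') - \<beta> * J1 + c * ((a + b) * J0 + (- (\<alpha> * J1') - \<beta> * J1) * l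
        - (\<alpha> * 0 - 0) - ((- (\<alpha> * Y1') + a * J0 - a) + (- (\<beta> * Y1) + b * J0 - b)))
      = - (\<alpha> * (J1' + c * (l * J1' - Y1')) - c * a) - (\<beta> * (J1 + c * (l * J1 - Y1)) - c * b)" for l \<alpha> \<beta>
    by (simp add: algebra_simps)
  note eq = this[of "A' / 2" "B' / 2"]
  show ?thesis
    unfolding polar_hankel_nat_def c_def[symmetric]
    by (rule DERIV_cong[OF DERIV_add[OF dJ DERIV_cmult[OF DERIV_diff[OF DERIV_diff[OF DERIV_mult[OF dL dJ] dT] dY]]]])
       (simp only: J0_def[symmetric] J1_def[symmetric] J1'_def[symmetric] Y1_def[symmetric] Y1'_def[symmetric]
         One_nat_def[symmetric] pole[folded One_nat_def] 1 2 3 4 a_def[symmetric] b_def[symmetric] eq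
         if_True refl mult_minus_left)
qed

lemma has_field_derivative_polar_hankel_nat_Suc:
  fixes A B L :: "complex \<Rightarrow> complex"
  assumes dA: "(A has_field_derivative A') (at e)"
    and dB: "(B has_field_derivative B') (at e)"
    and dL: "(L has_field_derivative A' / A e + B' / B e) (at e)"
    and nz: "A e \<noteq> 0" "B e \<noteq> 0"
  shows "((\<lambda>e. polar_hankel_nat (Suc n) (A e) (B e) (L e)) has_field_derivative
      A' / 2 * polar_hankel_nat n (A e) (B e) (L e)
      - B' / 2 * polar_hankel_nat (Suc (Suc n)) (A e) (B e) (L e)) (at e)"
proof -
  define c where "c = \<i> / of_real pi"
  define J0 J1 J2 Y0 Y2 T0 T2 X where "J0 = polar_J n (A e) (B e)" and "J1 = polar_J (Suc n) (A e) (B e)"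
    and "J2 = polar_J (Suc (Suc n)) (A e) (B e)"
    and "Y0 = polar_Y n (A e) (B e)" and "Y2 = polar_Y (Suc (Suc n)) (A e) (B e)"
    and "T0 = polar_pole n (A e) (B e)" and "T2 = polar_pole (Suc (Suc n)) (A e) (B e)"
    and "X = (A e / 2) ^ Suc n / fact (Suc n)"
  note dJ = has_field_derivative_polar_J_Suc[OF dA dB, of n]
  note dT = has_field_derivative_polar_pole[OF dA dB nz(2), of "Suc n"]
  note dY = has_field_derivative_polar_Y_Suc[OF dA dB nz, of n]
  define a b where "a = A' / A e" and "b = B' / B e"
  have 1: "A' * (Y0 / 2 + J1 / A e) = A' / 2 * Y0 + a * J1"
    by (simp add: a_def distrib_left)
  have 2: "B' * (- Y2 / 2 + J1 / B e - X / B e) = - (B' / 2 * Y2) + b * J1 - b * X"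
    by (simp add: b_def distrib_left right_diff_distrib)
  have 3: "B' / 2 * (T2 - X / (B e / 2)) = B' / 2 * T2 - b * X"
    using nz by (simp add: b_def right_diff_distrib)
  have "\<alpha> * J0 - \<beta> * J2 + c * ((a + b) * J1 + (\<alpha> * J0 - \<beta> * J2) * l
        - (\<alpha> * T0 - (\<beta> * T2 - b * X)) - (\<alpha> * Y0 + a * J1 + (- (\<beta> * Y2) + b * J1 - b * X)))
      = \<alpha> * (J0 + c * (l * J0 - T0 - Y0)) - \<beta> * (J2 + c * (l * J2 - T2 - Y2))" for l \<alpha> \<beta>
    by (simp add: algebra_simps)
  note eq = this[of "A' / 2" "B' / 2"]
  show ?thesis
    unfolding polar_hankel_nat_def c_def[symmetric]
    by (rule DERIV_cong[OF DERIV_add[OF dJ DERIV_cmult[OF DERIV_diff[OF DERIV_diff[OF DERIV_mult[OF dL dJ] dT] dY]]]])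
      (simp only: J0_def[symmetric] J1_def[symmetric] J2_def[symmetric] Y0_def[symmetric] Y2_def[symmetric]
        T0_def[symmetric] T2_def[symmetric] X_def[symmetric] diff_Suc_1 nat.distinct if_False 1 2 3 a_def[symmetric] b_def[symmetric] eq)
qed


text \<open>
  Order zero is symmetric in \<open>A\<close> and \<open>B\<close>; this glues the two ladders for positive and negative
  orders together.
\<close>

lemma polar_hankel_nat_0_commute: "polar_hankel_nat 0 B A L = polar_hankel_nat 0 A B L"
  by (simp add: polar_hankel_nat_def polar_J_def polar_Y_def polar_pole_def mult.commute)

lemma polar_hankel_of_nat [simp]: "polar_hankel (int n) A B L = polar_hankel_nat n A B L"
  by (simp add: polar_hankel_def)

lemma polar_hankel_of_nat_uminus: "polar_hankel (- int n) A B L = (- 1) ^ n * polar_hankel_nat n B A L"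
  using polar_hankel_nat_0_commute[of A B L] by (cases n) (simp_all add: polar_hankel_def del: of_nat_Suc)

lemma has_field_derivative_polar_hankel:
  fixes A B L :: "complex \<Rightarrow> complex"
  assumes dA: "(A has_field_derivative A') (at e)"
    and dB: "(B has_field_derivative B') (at e)"
    and dL: "(L has_field_derivative A' / A e + B' / B e) (at e)"
    and nz: "A e \<noteq> 0" "B e \<noteq> 0"
  shows "((\<lambda>e. polar_hankel m (A e) (B e) (L e)) has_field_derivative
      A' / 2 * polar_hankel (m - 1) (A e) (B e) (L e)
      - B' / 2 * polar_hankel (m + 1) (A e) (B e) (L e)) (at e)"
proof -
  consider "m = 0" | n where "m = int (Suc n)" | n where "m = - int (Suc n)"
    by (metis int_cases2 of_nat_0 not0_implies_Suc neg_0_equal_iff_equal)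
  then show ?thesis
  proof cases
    case 1
    have "polar_hankel (0 - 1) (A e) (B e) (L e) = - polar_hankel_nat 1 (B e) (A e) (L e)"
      "polar_hankel (0 + 1) (A e) (B e) (L e) = polar_hankel_nat 1 (A e) (B e) (L e)"
      by (simp_all add: polar_hankel_def)
    then show ?thesis
      using has_field_derivative_polar_hankel_nat_0[OF assms] unfolding 1
      by (simp add: polar_hankel_def)
  next
    case (2 n)
    have "m - 1 = int n" "m + 1 = int (Suc (Suc n))" using 2 by simp_all
    then show ?thesis
      using has_field_derivative_polar_hankel_nat_Suc[OF assms, of n] unfolding 2
      by (simp only: polar_hankel_of_nat)
  next
    case (3 n)
    have m: "m - 1 = - int (Suc (Suc n))" "m + 1 = - int n" using 3 by simp_all
    have dL': "(L has_field_derivative B' / B e + A' / A e) (at e)" using dL by (simp add: add.commute)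
    have "((\<lambda>e. (- 1) ^ Suc n * polar_hankel_nat (Suc n) (B e) (A e) (L e)) has_field_derivative
       (- 1) ^ Suc n * (B' / 2 * polar_hankel_nat n (B e) (A e) (L e)
         - A' / 2 * polar_hankel_nat (Suc (Suc n)) (B e) (A e) (L e))) (at e)"
      by (intro DERIV_cmult has_field_derivative_polar_hankel_nat_Suc[OF dB dA dL' nz(2,1)])
    then show ?thesis
      unfolding m unfolding 3 polar_hankel_of_nat_uminus by (simp add: algebra_simps)
  qed
qed

section \<open>Taylor expansion of the translated Hankel function\<close>

text \<open>
  At \<open>e = 0\<close> the path is at \<open>(u, u)\<close> with the principal logarithm, so it starts at the Hankel value
  itself. As long as \<open>|e a| < |u|\<close>, the number \<open>1 - e a / u\<close> stays in the right half-plane, and the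
  logarithm of \<open>A\<close> is continued without meeting a cut even if \<open>A\<close> crosses the negative axis.
\<close>

definition graf_path :: "complex \<Rightarrow> complex \<Rightarrow> complex \<Rightarrow> int \<Rightarrow> complex \<Rightarrow> complex" where
  "graf_path u a b m e = polar_hankel m (u - e * a) (u - e * b)
     (2 * Ln (u / 2) + Ln (1 - e * a / u) + Ln (1 - e * b / u))"

text \<open>
  The weight of \<open>i\<close> lowering and \<open>j\<close> raising steps, from a Taylor coefficient of order \<open>i + j\<close>.
\<close>

definition graf_coeff :: "complex \<Rightarrow> complex \<Rightarrow> nat \<Rightarrow> nat \<Rightarrow> complex" where
  "graf_coeff a b i j = (- a / 2) ^ i * (b / 2) ^ j / (fact i * fact j)"

lemma has_field_derivative_Ln_one_minus:
  assumes "norm (e * a) < norm (u :: complex)"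
  shows "((\<lambda>e. Ln (1 - e * a / u)) has_field_derivative - a / (u - e * a)) (at e)"
    and "u - e * a \<noteq> 0"
proof -
  have u: "u \<noteq> 0" using assms by (metis norm_zero norm_not_less_zero)
  show nz: "u - e * a \<noteq> 0" using assms by (metis eq_iff_diff_eq_0 less_irrefl)
  have "norm (e * a / u) < 1" using assms u by (simp add: norm_divide)
  then have "Re (e * a / u) < 1" using complex_Re_le_cmod order_le_less_trans by blast
  then have "1 - e * a / u \<notin> \<real>\<^sub>\<le>\<^sub>0" by (auto simp: complex_nonpos_Reals_iff)
  then have "((\<lambda>e. Ln (1 - e * a / u)) has_field_derivative inverse (1 - e * a / u) * (- (a / u))) (at e)"
    by (auto intro!: derivative_eq_intros simp: u)
  moreover have "inverse (1 - e * a / u) * (- (a / u)) = - a / (u - e * a)"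
    using u nz by (simp add: field_simps)
  ultimately show "((\<lambda>e. Ln (1 - e * a / u)) has_field_derivative - a / (u - e * a)) (at e)" by simp
qed

lemma has_field_derivative_graf_path:
  assumes "norm (e * a) < norm u" "norm (e * b) < norm u"
  shows "(graf_path u a b m has_field_derivative
     (- a / 2) * graf_path u a b (m - 1) e + b / 2 * graf_path u a b (m + 1) e) (at e)"
proof -
  have dA: "((\<lambda>e. u - e * a) has_field_derivative - a) (at e)" for a
    by (auto intro!: derivative_eq_intros)
  have dL: "((\<lambda>e. 2 * Ln (u / 2) + Ln (1 - e * a / u) + Ln (1 - e * b / u)) has_field_derivative
      - a / (u - e * a) + - b / (u - e * b)) (at e)"
    using DERIV_add[OF DERIV_add[OF DERIV_const has_field_derivative_Ln_one_minus(1)[OF assms(1)]]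
        has_field_derivative_Ln_one_minus(1)[OF assms(2)]] by simp
  from has_field_derivative_polar_hankel[OF dA dA dL has_field_derivative_Ln_one_minus(2)[OF assms(1)]
      has_field_derivative_Ln_one_minus(2)[OF assms(2)], of m]
  show ?thesis unfolding graf_path_def[abs_def] by simp
qed

lemma graf_coeff_Suc:
  "graf_coeff a b i j * (- a / 2) = of_nat (Suc i) * graf_coeff a b (Suc i) j"
  "graf_coeff a b i j * (b / 2) = of_nat (Suc j) * graf_coeff a b i (Suc j)"
proof -
  have 1: "x * y / (f * g) * c = m * (c * x * y / (m * f * g))"
    "x * y / (f * g) * c = m * (x * (c * y) / (f * (m * g)))" if "m \<noteq> 0" for x y f g c m :: complex
    using that by (simp_all add: mult_ac)
  show "graf_coeff a b i j * (- a / 2) = of_nat (Suc i) * graf_coeff a b (Suc i) j"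
    unfolding graf_coeff_def power_Suc fact_Suc by (rule 1(1)) (simp only: of_nat_eq_0_iff nat.distinct not_False_eq_True)
  show "graf_coeff a b i j * (b / 2) = of_nat (Suc j) * graf_coeff a b i (Suc j)"
    unfolding graf_coeff_def power_Suc fact_Suc by (rule 1(2)) (simp only: of_nat_eq_0_iff nat.distinct not_False_eq_True)
qed

text \<open>
  Each step of the derivative either lowers the order with weight \<open>-a/2\<close> or raises it with weight
  \<open>b/2\<close>, and the two steps commute. The sums here are the resulting binomial expansions divided by
  \<open>n!\<close>, i.e. the Taylor coefficients; differentiating one yields \<open>n + 1\<close> times the next.
\<close>

lemma has_field_derivative_graf_path_sum:
  assumes "norm (e * a) < norm u" "norm (e * b) < norm u"
  shows "((\<lambda>e. \<Sum>i\<le>n. graf_coeff a b i (n - i) * graf_path u a b (int n - 2 * int i) e) has_field_derivative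
     of_nat (Suc n) * (\<Sum>i\<le>Suc n. graf_coeff a b i (Suc n - i) * graf_path u a b (int (Suc n) - 2 * int i) e)) (at e)"
proof -
  define T where "T i = graf_coeff a b i (Suc n - i) * graf_path u a b (int (Suc n) - 2 * int i) e" for i
  have "((\<lambda>e. \<Sum>i\<le>n. graf_coeff a b i (n - i) * graf_path u a b (int n - 2 * int i) e) has_field_derivative
     (\<Sum>i\<le>n. graf_coeff a b i (n - i) * ((- a / 2) * graf_path u a b (int n - 2 * int i - 1) e
        + b / 2 * graf_path u a b (int n - 2 * int i + 1) e))) (at e)"
    by (intro DERIV_sum DERIV_cmult has_field_derivative_graf_path assms)
  also have "(\<Sum>i\<le>n. graf_coeff a b i (n - i) * ((- a / 2) * graf_path u a b (int n - 2 * int i - 1) e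
        + b / 2 * graf_path u a b (int n - 2 * int i + 1) e))
      = (\<Sum>i\<le>n. of_nat (Suc i) * T (Suc i) + of_nat (Suc n - i) * T i)"
  proof (rule sum.cong[OF refl])
    fix i assume "i \<in> {..n}"
    then have i: "Suc n - i = Suc (n - i)" by auto
    have m: "int (Suc n) - 2 * int (Suc i) = int n - 2 * int i - 1"
      "int (Suc n) - 2 * int i = int n - 2 * int i + 1" by simp_all
    show "graf_coeff a b i (n - i) * ((- a / 2) * graf_path u a b (int n - 2 * int i - 1) e
        + b / 2 * graf_path u a b (int n - 2 * int i + 1) e)
      = of_nat (Suc i) * T (Suc i) + of_nat (Suc n - i) * T i"
      unfolding T_def m i diff_Suc_Suc distrib_left mult.assoc[symmetric] graf_coeff_Suc ..
  qed
  also have "\<dots> = (\<Sum>i\<le>Suc n. of_nat i * T i) + (\<Sum>i\<le>Suc n. of_nat (Suc n - i) * T i)"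
    by (subst sum.atMost_Suc_shift[of "\<lambda>i. of_nat i * T i"]) (simp add: sum.distrib)
  also have "\<dots> = (\<Sum>i\<le>Suc n. of_nat (Suc n) * T i)"
    unfolding sum.distrib[symmetric]
  proof (rule sum.cong[OF refl])
    fix i assume "i \<in> {..Suc n}"
    then have "i + (Suc n - i) = Suc n" by auto
    then have "of_nat i + of_nat (Suc n - i) = (of_nat (Suc n) :: complex)"
      by (metis of_nat_add)
    then show "of_nat i * T i + of_nat (Suc n - i) * T i = of_nat (Suc n) * T i"
      by (simp only: distrib_right[symmetric])
  qed
  finally show ?thesis
    unfolding T_def sum_distrib_left[symmetric] .
qed

text \<open>
  This is the Taylor series of \<open>graf_path u a b 0\<close> about \<open>e = 0\<close>, evaluated at \<open>e = 1\<close>. The function is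
  holomorphic on a disc that contains \<open>1\<close> because \<open>|a|\<close> and \<open>|b|\<close> are strictly less than \<open>|u|\<close>.
\<close>

lemma graf_taylor:
  assumes "norm a < norm u" "norm b < norm u"
  shows "(\<lambda>n. \<Sum>i\<le>n. graf_coeff a b i (n - i) * hankel1 (int n - 2 * int i) u) sums graf_path u a b 0 1"
proof -
  define v where "v = max (norm a) (norm b)"
  have v: "0 \<le> v" "v < norm u" "norm a \<le> v" "norm b \<le> v" using assms by (auto simp: v_def le_max_iff_disj)
  have u: "u \<noteq> 0" using v by auto
  \<comment> \<open>a radius larger than \<open>1\<close>, so that \<open>e = 1\<close> is inside, but with \<open>R v < |u|\<close>\<close>
  define R where "R = 2 * norm u / (norm u + v)"
  have R: "1 < R" using v by (simp add: R_def field_simps)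
  have dom: "norm (e * c) < norm u" if "e \<in> ball 0 R" "norm c \<le> v" for e c :: complex
  proof -
    have pos: "0 < norm u + v" using v by simp
    have "norm (e * c) \<le> R * v"
      unfolding norm_mult using that R by (intro mult_mono) (auto intro: less_imp_le)
    also have "R * v < norm u"
    proof -
      have "2 * v < norm u + v" using v by simp
      then have "norm u * (2 * v) < norm u * (norm u + v)" using u by (intro mult_strict_left_mono) auto
      then show ?thesis using pos by (simp add: R_def pos_divide_less_eq mult_ac)
    qed
    finally show ?thesis .
  qed
  define G where "G n e = (\<Sum>i\<le>n. graf_coeff a b i (n - i) * graf_path u a b (int n - 2 * int i) e)" for n e
  have dG: "(G n has_field_derivative of_nat (Suc n) * G (Suc n) e) (at e)" if "e \<in> ball 0 R" for n e
    unfolding G_def using has_field_derivative_graf_path_sum[OF dom[OF that v(3)] dom[OF that v(4)]] .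
  have G0: "G 0 = graf_path u a b 0"
    by (simp add: G_def graf_coeff_def fun_eq_iff)
  have higher: "(deriv ^^ n) (G 0) e = fact n * G n e" if "e \<in> ball 0 R" for n e
    using that
  proof (induction n arbitrary: e)
    case (Suc n)
    have "eventually (\<lambda>x. x \<in> ball 0 R) (nhds e)"
      using Suc.prems by (intro eventually_nhds_in_open) auto
    then have "eventually (\<lambda>x. (deriv ^^ n) (G 0) x = fact n * G n x) (nhds e)"
      by eventually_elim (rule Suc.IH)
    then have "deriv ((deriv ^^ n) (G 0)) e = deriv (\<lambda>x. fact n * G n x) e"
      by (rule deriv_cong_ev) simp
    also have "\<dots> = fact n * (of_nat (Suc n) * G (Suc n) e)"
      by (intro DERIV_imp_deriv DERIV_cmult dG Suc.prems)
    finally show ?case by (simp add: mult_ac)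
  qed simp
  have "G 0 holomorphic_on ball 0 R"
    unfolding holomorphic_on_open[OF open_ball] using dG by blast
  then have "(\<lambda>n. (deriv ^^ n) (G 0) 0 / fact n * (1 - 0) ^ n) sums G 0 1"
    using R by (intro holomorphic_power_series) auto
  then have "(\<lambda>n. G n 0) sums G 0 1"
    using R by (simp add: higher)
  moreover have "graf_path u a b m 0 = hankel1 m u" for m
    using hankel1_eq_polar_hankel[OF u] by (simp add: graf_path_def)
  ultimately show ?thesis unfolding G0 by (simp add: G_def)
qed

section \<open>Growth of the Bessel and Hankel functions in the order\<close>

lemma hankel1_of_nat:
  "u \<noteq> 0 \<Longrightarrow> hankel1 (int n) u = polar_hankel_nat n u u (2 * Ln (u / 2))"
  by (simp add: hankel1_eq_polar_hankel)

lemma hankel1_uminus: "hankel1 (- int n) u = (- 1) ^ n * hankel1 (int n) u"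
  by (cases n) (simp_all add: hankel1_def bessel_J_def bessel_Y_def algebra_simps del: of_nat_Suc)

lemma norm_polar_J_le:
  assumes "norm A \<le> \<rho>" "norm B \<le> \<rho>"
  shows "norm (polar_J n A B) \<le> (\<rho> / 2) ^ n / fact n * exp (\<rho>\<^sup>2 / 4)"
proof -
  have \<rho>: "0 \<le> \<rho>" using assms(1) norm_ge_zero order_trans by blast
  have "norm (A * B) \<le> \<rho>\<^sup>2"
    unfolding norm_mult power2_eq_square using assms \<rho> by (intro mult_mono) auto
  then have "norm (reduced_J n (A * B)) \<le> exp (\<rho>\<^sup>2 / 4) / fact n"
    by (intro order_trans[OF norm_reduced_J_le]) (simp add: divide_right_mono)
  moreover have "norm ((A / 2) ^ n) \<le> (\<rho> / 2) ^ n"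
    unfolding norm_power using assms by (intro power_mono) (simp_all add: norm_divide)
  ultimately have "norm (polar_J n A B) \<le> (\<rho> / 2) ^ n * (exp (\<rho>\<^sup>2 / 4) / fact n)"
    unfolding polar_J_def norm_mult using \<rho> by (intro mult_mono) auto
  then show ?thesis by simp
qed

lemma norm_polar_Y_le:
  assumes "norm A \<le> \<rho>" "norm B \<le> \<rho>"
  shows "norm (polar_Y n A B) \<le> (\<rho> / 2) ^ n * (4 * exp (\<rho>\<^sup>2 / 4))"
proof -
  have \<rho>: "0 \<le> \<rho>" using assms(1) norm_ge_zero order_trans by blast
  have "norm (A * B) \<le> \<rho>\<^sup>2"
    unfolding norm_mult power2_eq_square using assms \<rho> by (intro mult_mono) auto
  then have "norm (reduced_Y n (A * B)) \<le> 4 * exp (\<rho>\<^sup>2 / 4)"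
    by (intro order_trans[OF norm_reduced_Y_le]) simp
  moreover have "norm ((A / 2) ^ n) \<le> (\<rho> / 2) ^ n"
    unfolding norm_power using assms by (intro power_mono) (simp_all add: norm_divide)
  ultimately show "norm (polar_Y n A B) \<le> (\<rho> / 2) ^ n * (4 * exp (\<rho>\<^sup>2 / 4))"
    unfolding polar_Y_def norm_mult using \<rho> by (intro mult_mono) auto
qed

lemma exp_sums_real: "(\<lambda>s. x ^ s / fact s) sums exp (x :: real)"
  using exp_converges[of x] by (simp add: divide_inverse mult.commute)

lemma exp_partial_sum_le:
  fixes x :: real
  assumes "0 \<le> x"
  shows "(\<Sum>s<n. x ^ s / fact s) \<le> exp x"
  using sum_le_suminf[OF sums_summable[OF exp_sums_real], of "{..<n}" x] assms
    sums_unique[OF exp_sums_real[of x]] by simp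

lemma power_le_fact_exp:
  fixes x :: real
  assumes "0 \<le> x"
  shows "x ^ n \<le> fact n * exp x"
proof -
  have "x ^ n / fact n \<le> (\<Sum>s<Suc n. x ^ s / fact s)"
    unfolding sum.lessThan_Suc using assms by (simp add: sum_nonneg)
  also have "\<dots> \<le> exp x" by (rule exp_partial_sum_le[OF assms])
  finally show ?thesis by (simp add: field_simps)
qed

text \<open>
  Here \<open>(n - s)! \<le> n!\<close> is used in every summand, which leaves a partial sum of the exponential series.
\<close>

lemma norm_polar_pole_le:
  assumes "z \<noteq> 0"
  shows "norm (polar_pole (Suc n) z z) \<le> fact n / (norm z / 2) ^ Suc n * exp ((norm z / 2)\<^sup>2)"
proof -
  define w where "w = norm z / 2"
  have w: "0 < w" using assms by (simp add: w_def)
  have "norm (polar_pole (Suc n) z z) \<le> (\<Sum>s<Suc n. fact n / w ^ Suc n * ((w\<^sup>2) ^ s / fact s))"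
    unfolding polar_pole_def
  proof (rule sum_norm_le)
    fix s assume s: "s \<in> {..<Suc n}"
    then have split: "w ^ Suc n = w ^ (Suc n - s) * w ^ s"
      by (subst power_add[symmetric]) simp
    have cancel: "1 / y = 1 / (y * x) * x" if "x \<noteq> 0" for x y :: real using that by simp
    have "norm (fact (Suc n - s - 1) / fact s * (z / 2) ^ s / (z / 2) ^ (Suc n - s))
      = fact (Suc n - s - 1) / fact s * w ^ s * (1 / w ^ (Suc n - s))"
      by (simp add: norm_mult norm_divide norm_power w_def)
    also have "\<dots> \<le> fact n / fact s * w ^ s * (1 / w ^ (Suc n - s))"
      using w by (intro mult_right_mono divide_right_mono fact_mono) auto
    also have "1 / w ^ (Suc n - s) = 1 / w ^ Suc n * w ^ s"
      unfolding split by (rule cancel) (use w in simp)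
    also have "fact n / fact s * w ^ s * (1 / w ^ Suc n * w ^ s) = fact n / w ^ Suc n * ((w\<^sup>2) ^ s / fact s)"
      by (simp add: power2_eq_square power_mult_distrib mult_ac)
    finally show "norm (fact (Suc n - s - 1) / fact s * (z / 2) ^ s / (z / 2) ^ (Suc n - s))
       \<le> fact n / w ^ Suc n * ((w\<^sup>2) ^ s / fact s)" .
  qed
  also have "\<dots> = fact n / w ^ Suc n * (\<Sum>s<Suc n. (w\<^sup>2) ^ s / fact s)"
    by (rule sum_distrib_left[symmetric])
  also have "\<dots> \<le> fact n / w ^ Suc n * exp (w\<^sup>2)"
    using w by (intro mult_left_mono exp_partial_sum_le) auto
  finally show ?thesis unfolding w_def .
qed

text \<open>
  The constant in the Hankel bound for arguments with \<open>|z| \<le> R\<close> and \<open>|Ln (z/2)| \<le> \<Lambda>\<close>. The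
  first summand accounts for the singular part of \<open>Y\<^sub>n\<close>; the second for \<open>J\<^sub>n\<close>, the
  logarithmic term and the digamma series.
\<close>

definition hankel_const :: "real \<Rightarrow> real \<Rightarrow> real" where
  "hankel_const R \<Lambda> = exp (R\<^sup>2 / 4) + (5 + 2 * \<Lambda>) * (R\<^sup>2 / 4) * (exp (R\<^sup>2 / 4))\<^sup>2"

text \<open>
  The regular parts are \<open>O(|z/2|\<^sup>n)\<close>. They fit under the bound for the singular part since
  \<open>|z/2|\<^sup>2\<^sup>n\<close> is at most a constant times \<open>(n - 1)!\<close>.
\<close>

lemma norm_hankel1_le:
  assumes z: "z \<noteq> 0" "norm z \<le> R" "norm (Ln (z / 2)) \<le> \<Lambda>"
  shows "norm (hankel1 (int (Suc n)) z) \<le> hankel_const R \<Lambda> * fact n / (norm z / 2) ^ Suc n"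
proof -
  define w E where "w = norm z / 2" and "E = exp (R\<^sup>2 / 4)"
  have w: "0 < w" using z by (simp add: w_def)
  have \<Lambda>: "0 \<le> \<Lambda>" using z(3) norm_ge_zero order_trans by blast
  have wR: "w\<^sup>2 \<le> R\<^sup>2 / 4"
    using power_mono[OF z(2), of 2] by (simp add: w_def power_divide)
  have E: "exp (w\<^sup>2) \<le> E" "exp ((norm z)\<^sup>2 / 4) \<le> E" "1 \<le> E"
    using wR by (simp_all add: E_def w_def power_divide)
  have J: "norm (polar_J (Suc n) z z) \<le> w ^ Suc n * E"
  proof -
    have "norm (polar_J (Suc n) z z) \<le> w ^ Suc n / fact (Suc n) * exp ((norm z)\<^sup>2 / 4)"
      using norm_polar_J_le[of z "norm z" z "Suc n"] by (simp only: w_def order_refl simp_thms)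
    also have "\<dots> \<le> w ^ Suc n / 1 * E"
      using w E by (intro mult_mono divide_left_mono fact_ge_1) auto
    finally show ?thesis by simp
  qed
  have Y: "norm (polar_Y (Suc n) z z) \<le> w ^ Suc n * (4 * E)"
  proof -
    have "norm (polar_Y (Suc n) z z) \<le> w ^ Suc n * (4 * exp ((norm z)\<^sup>2 / 4))"
      using norm_polar_Y_le[of z "norm z" z "Suc n"] by (simp only: w_def order_refl simp_thms)
    also have "\<dots> \<le> w ^ Suc n * (4 * E)"
      using w E by (intro mult_left_mono) auto
    finally show ?thesis .
  qed
  have T: "norm (polar_pole (Suc n) z z) \<le> fact n / w ^ Suc n * E"
  proof -
    have "norm (polar_pole (Suc n) z z) \<le> fact n / w ^ Suc n * exp (w\<^sup>2)"
      using norm_polar_pole_le[OF z(1), of n] by (simp only: w_def)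
    also have "\<dots> \<le> fact n / w ^ Suc n * E"
      using w E by (intro mult_left_mono) auto
    finally show ?thesis .
  qed
  have pow: "w ^ Suc n \<le> fact n / w ^ Suc n * (R\<^sup>2 / 4 * E)"
  proof -
    have "w ^ Suc n * w ^ Suc n = w\<^sup>2 * (w\<^sup>2) ^ n"
      by (simp add: power2_eq_square power_mult_distrib)
    also have "\<dots> \<le> R\<^sup>2 / 4 * (fact n * E)"
    proof (rule mult_mono[OF wR])
      show "(w\<^sup>2) ^ n \<le> fact n * E"
        by (rule order_trans[OF power_le_fact_exp mult_left_mono[OF E(1)]]) simp_all
    qed auto
    finally have "w ^ Suc n * w ^ Suc n \<le> R\<^sup>2 / 4 * (fact n * E)" .
    then have "w ^ Suc n \<le> R\<^sup>2 / 4 * (fact n * E) / w ^ Suc n"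
      using w by (subst pos_le_divide_eq) (simp_all del: power_Suc)
    then show ?thesis by (simp add: mult_ac)
  qed
  have tri: "norm (x + c * (l * x - t - y)) \<le> norm x + (norm l * norm x + norm t + norm y)"
    if "norm c \<le> 1" for x c l t y :: complex
  proof -
    have "norm (l * x - t - y) \<le> norm l * norm x + norm t + norm y"
      using norm_triangle_ineq4[of "l * x - t" y] norm_triangle_ineq4[of "l * x" t]
      by (simp add: norm_mult)
    then have "norm c * norm (l * x - t - y) \<le> 1 * (norm l * norm x + norm t + norm y)"
      using that by (intro mult_mono) auto
    then show ?thesis
      using norm_triangle_ineq[of x "c * (l * x - t - y)"] by (simp add: norm_mult)
  qed
  have "1 \<le> pi" using pi_gt3 by simp
  then have c: "norm (\<i> / of_real pi :: complex) \<le> 1" by (simp add: norm_divide)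
  have l: "norm (2 * Ln (z / 2)) * norm (polar_J (Suc n) z z) \<le> 2 * \<Lambda> * (w ^ Suc n * E)"
    using z(3) J \<Lambda> by (intro mult_mono) (auto simp: norm_mult)
  have "norm (hankel1 (int (Suc n)) z) \<le> norm (polar_J (Suc n) z z)
     + (norm (2 * Ln (z / 2)) * norm (polar_J (Suc n) z z) + norm (polar_pole (Suc n) z z)
        + norm (polar_Y (Suc n) z z))"
    unfolding hankel1_of_nat[OF z(1)] polar_hankel_nat_def by (rule tri[OF c])
  also have "\<dots> \<le> w ^ Suc n * E + (2 * \<Lambda> * (w ^ Suc n * E) + fact n / w ^ Suc n * E + w ^ Suc n * (4 * E))"
    by (intro add_mono J l T Y)
  also have "\<dots> = w ^ Suc n * ((5 + 2 * \<Lambda>) * E) + fact n / w ^ Suc n * E"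
    by (simp add: algebra_simps)
  also have "\<dots> \<le> fact n / w ^ Suc n * (R\<^sup>2 / 4 * E) * ((5 + 2 * \<Lambda>) * E) + fact n / w ^ Suc n * E"
    using \<Lambda> E by (intro add_right_mono mult_right_mono pow) auto
  also have "\<dots> = hankel_const R \<Lambda> * fact n / w ^ Suc n"
  proof -
    have "f / W * (r * E) * (k * E) + f / W * E = (E + k * r * (E * E)) * f / W" for f W r k :: real
      by (simp add: algebra_simps add_divide_distrib)
    then show ?thesis
      unfolding hankel_const_def E_def[symmetric] power2_eq_square[of E] .
  qed
  finally show ?thesis unfolding w_def .
qed

section \<open>Graf's addition theorem\<close>

text \<open>
  The diagonals \<open>j - i = m\<close> are split into those on or above the main diagonal and those strictly
  below it, so that both families are indexed by natural numbers.
\<close>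

lemma sums_antidiagonals_eq_diagonals:
  fixes g :: "nat \<Rightarrow> nat \<Rightarrow> complex"
  assumes "(\<lambda>(i, j). g i j) summable_on UNIV"
    and antidiagonals: "(\<lambda>n. \<Sum>i\<le>n. g i (n - i)) sums S"
    and upper: "\<And>m. (\<lambda>s. g s (s + m)) sums U m"
    and lower: "\<And>m. (\<lambda>s. g (s + Suc m) s) sums V m"
  shows "\<exists>S1 S2. U sums S1 \<and> V sums S2 \<and> S = S1 + S2"
proof -
  define f where "f = (\<lambda>(i, j). g i j)"
  have slices: "W sums T"
    if "(f has_sum T) X" "bij_betw h (UNIV \<times> UNIV) X" "\<And>m. (\<lambda>s. f (h (m, s))) sums W m"
    for T X W and h :: "nat \<times> nat \<Rightarrow> nat \<times> nat"
  proof -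
    have h: "((\<lambda>p. f (h p)) has_sum T) (UNIV \<times> UNIV)"
      using that(1) has_sum_reindex_bij_betw[OF that(2)] by blast
    have "(W has_sum T) UNIV"
    proof (rule has_sum_SigmaD[OF h])
      fix m :: nat
      have "(\<lambda>(x, y). f (h (x, y))) summable_on UNIV \<times> UNIV"
        using h by (auto simp: summable_on_def case_prod_unfold)
      then have "(\<lambda>s. f (h (m, s))) summable_on UNIV"
        using summable_on_SigmaD1[of "\<lambda>x y. f (h (x, y))" UNIV "\<lambda>_. UNIV" m] by simp
      then obtain c where c: "((\<lambda>s. f (h (m, s))) has_sum c) UNIV"
        unfolding summable_on_def by blast
      with sums_unique2[OF has_sum_imp_sums[OF c] that(3)]
      show "((\<lambda>s. f (h (m, s))) has_sum W m) UNIV" by simp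
    qed
    then show "W sums T" by (rule has_sum_imp_sums)
  qed
  have summable: "f summable_on X" for X
    using assms(1) unfolding f_def by (rule summable_on_subset_banach) simp
  define up where "up = {(i, j). i \<le> (j :: nat)}"
  define low where "low = {(i, j). (j :: nat) < i}"
  obtain S1 S2 where S1: "(f has_sum S1) up" and S2: "(f has_sum S2) low"
    using summable unfolding summable_on_def by metis
  have "up \<inter> low = {}" "up \<union> low = UNIV" by (auto simp: up_def low_def)
  with has_sum_Un_disjoint[OF S1 S2] have total: "(f has_sum S1 + S2) UNIV" by simp
  have "U sums S1"
  proof (rule slices[OF S1])
    show "bij_betw (\<lambda>(m, s). (s, s + m)) (UNIV \<times> UNIV) up"
      by (rule bij_betwI[where g = "\<lambda>(i, j). (j - i, i)"]) (auto simp: up_def)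
  qed (use upper in \<open>simp add: f_def\<close>)
  moreover have "V sums S2"
  proof (rule slices[OF S2])
    show "bij_betw (\<lambda>(m, s). (s + Suc m, s)) (UNIV \<times> UNIV) low"
      by (rule bij_betwI[where g = "\<lambda>(i, j). (i - Suc j, j)"]) (auto simp: low_def)
  qed (use lower in \<open>simp add: f_def\<close>)
  moreover have "(\<lambda>n. \<Sum>i\<le>n. g i (n - i)) sums (S1 + S2)"
  proof -
    have "bij_betw (\<lambda>(n, i). (i, n - i)) (SIGMA n:UNIV. {..n}) (UNIV :: (nat \<times> nat) set)"
      by (rule bij_betwI[where g = "\<lambda>(i, j). (i + j, i)"]) auto
    from has_sum_reindex_bij_betw[OF this, of f] total
    have "((\<lambda>p. f (case p of (n, i) \<Rightarrow> (i, n - i))) has_sum S1 + S2) (SIGMA n:UNIV. {..n})" by blast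
    then have "((\<lambda>n. \<Sum>i\<le>n. g i (n - i)) has_sum S1 + S2) UNIV"
      by (rule has_sum_SigmaD) (auto simp: f_def intro!: has_sum_finiteI)
    then show ?thesis by (rule has_sum_imp_sums)
  qed
  ultimately show ?thesis using sums_unique2[OF antidiagonals] by metis
qed

text \<open>
  The orders \<open>m\<close> and \<open>-m\<close> of the bilateral Graf series are combined into one term.
\<close>

definition graf_term :: "complex \<Rightarrow> complex \<Rightarrow> complex \<Rightarrow> nat \<Rightarrow> complex" where
  "graf_term u a b m = hankel1 (int m) u * (polar_J m b a + (if m = 0 then 0 else polar_J m a b))"

lemma graf_coeff_diagonal_sums:
  "(\<lambda>s. graf_coeff a b s (s + m)) sums polar_J m b a"
  "(\<lambda>s. graf_coeff a b (s + m) s) sums ((- 1) ^ m * polar_J m a b)"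
proof -
  have sums: "(\<lambda>s. J_coeff m s * q ^ s) sums reduced_J m q" for q
    unfolding reduced_J_def by (rule summable_sums[OF reduced_J_summable])
  have q: "(- a / 2) ^ s * (b / 2) ^ s = (- 1 / 4) ^ s * (a * b) ^ s" for s
    unfolding power_mult_distrib[symmetric] by simp
  have "graf_coeff a b s (s + m) = (b / 2) ^ m * (J_coeff m s * (b * a) ^ s)" for s
  proof -
    have "graf_coeff a b s (s + m) = ((- a / 2) ^ s * (b / 2) ^ s) * (b / 2) ^ m / (fact s * fact (m + s))"
      by (simp add: graf_coeff_def power_add add.commute)
    then show ?thesis unfolding q J_coeff_def by (simp add: mult_ac)
  qed
  with sums_mult[OF sums] show "(\<lambda>s. graf_coeff a b s (s + m)) sums polar_J m b a"
    unfolding polar_J_def by simp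
  have "graf_coeff a b (s + m) s = (- 1) ^ m * (a / 2) ^ m * (J_coeff m s * (a * b) ^ s)" for s
  proof -
    have "(- a / 2) ^ m = (- 1) ^ m * (a / 2) ^ m"
      unfolding power_mult_distrib[symmetric] by simp
    then have "graf_coeff a b (s + m) s
        = ((- a / 2) ^ s * (b / 2) ^ s) * ((- 1) ^ m * (a / 2) ^ m) / (fact s * fact (m + s))"
      by (simp only: graf_coeff_def power_add add.commute[of s m]) (simp only: mult_ac)
    then show ?thesis unfolding q J_coeff_def by (simp add: mult_ac)
  qed
  with sums_mult[OF sums, of "(- 1) ^ m * (a / 2) ^ m"]
  show "(\<lambda>s. graf_coeff a b (s + m) s) sums ((- 1) ^ m * polar_J m a b)"
    unfolding polar_J_def by (simp add: mult.assoc)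
qed


text \<open>
  On the diagonals of order \<open>m\<close> and \<open>-m\<close> the entry number \<open>s\<close> is bounded by a constant times
  \<open>(v/|u|)\<^sup>m (v\<^sup>2/4)\<^sup>s / s!\<close> with \<open>v = max |a| |b|\<close>: the factorial growth of the Hankel function is
  compensated by \<open>(s + m)! \<ge> s! m!\<close>.
\<close>

lemma graf_series_summable:
  assumes "norm a < norm u" "norm b < norm u"
  shows "(\<lambda>(i, j). graf_coeff a b i j * hankel1 (int j - int i) u) summable_on UNIV"
proof -
  define v where "v = max (norm a) (norm b)"
  have v: "0 \<le> v" "v < norm u" "norm a \<le> v" "norm b \<le> v" using assms by (auto simp: v_def le_max_iff_disj)
  then have u: "u \<noteq> 0" by auto
  define K where "K = norm (hankel1 0 u) + hankel_const (norm u) (norm (Ln (u / 2)))"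
  have hc: "0 \<le> hankel_const (norm u) (norm (Ln (u / 2)))"
    by (simp add: hankel_const_def)
  have K: "0 \<le> K" using hc by (simp add: K_def)
  have hankel: "(v / 2) ^ m / fact m * norm (hankel1 (int m) u) \<le> K * (v / norm u) ^ m" for m
  proof (cases m)
    case (Suc n)
    define c where "c = hankel_const (norm u) (norm (Ln (u / 2)))"
    have "(v / 2) ^ m / fact m * norm (hankel1 (int m) u)
       \<le> (v / 2) ^ m / fact m * (c * fact n / (norm u / 2) ^ m)"
      unfolding Suc c_def using v u
      by (intro mult_left_mono norm_hankel1_le) auto
    also have "\<dots> = c * ((v / 2) / (norm u / 2)) ^ m * (fact n / fact m)"
      by (simp only: power_divide[of "v / 2" "norm u / 2"]) (simp only: times_divide_eq_left times_divide_eq_right divide_divide_eq_left mult_ac)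
    also have "\<dots> \<le> c * ((v / 2) / (norm u / 2)) ^ m * 1"
      using hc v by (intro mult_left_mono) (auto simp: c_def Suc divide_le_eq fact_mono)
    also have "\<dots> \<le> K * ((v / 2) / (norm u / 2)) ^ m"
      using v by (simp add: K_def c_def mult_right_mono)
    finally show ?thesis using u by simp
  qed (use hc in \<open>simp add: K_def\<close>)
  define y where "y s = (v\<^sup>2 / 4) ^ s / fact s" for s
  have y: "y sums exp (v\<^sup>2 / 4)"
    unfolding y_def by (rule exp_sums_real)
  have fact_split: "1 / (fact s * fact (s + m)) \<le> 1 / fact s * (1 / fact m :: real)" for s m
    by (simp add: divide_simps fact_mono)
  have pow_split: "(v / 2) ^ s * (v / 2) ^ (s + m) = (v\<^sup>2 / 4) ^ s * (v / 2) ^ m" for s m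
    unfolding power_add mult.assoc[symmetric] power_mult_distrib[symmetric] by (simp add: power2_eq_square)
  have half: "norm ((- a / 2) ^ i) \<le> (v / 2) ^ i" "norm ((b / 2) ^ i) \<le> (v / 2) ^ i" for i
    unfolding norm_power using v by (intro power_mono; simp add: norm_divide)+
  have diag: "(v / 2) ^ s * (v / 2) ^ (s + m) / (fact s * fact (s + m)) * norm (hankel1 (int m) u)
      \<le> K * (v / norm u) ^ m * y s" for s m
  proof -
    have "(v / 2) ^ s * (v / 2) ^ (s + m) / (fact s * fact (s + m)) * norm (hankel1 (int m) u)
       = (v\<^sup>2 / 4) ^ s * (v / 2) ^ m * (1 / (fact s * fact (s + m))) * norm (hankel1 (int m) u)"
      unfolding pow_split by simp
    also have "\<dots> \<le> (v\<^sup>2 / 4) ^ s * (v / 2) ^ m * (1 / fact s * (1 / fact m)) * norm (hankel1 (int m) u)"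
      using v by (intro mult_right_mono mult_left_mono fact_split) auto
    also have "\<dots> = y s * ((v / 2) ^ m / fact m * norm (hankel1 (int m) u))"
      by (simp add: y_def mult_ac)
    also have "\<dots> \<le> y s * (K * (v / norm u) ^ m)"
      using v by (intro mult_left_mono hankel) (simp add: y_def)
    finally show ?thesis by (simp only: mult_ac)
  qed
  define majorant where "majorant = (\<lambda>(m, s). K * (v / norm u) ^ m * y s)"
  have "majorant summable_on UNIV \<times> UNIV"
  proof (rule summable_on_SigmaI)
    fix m :: nat
    have "((\<lambda>s. K * (v / norm u) ^ m * y s) has_sum K * (v / norm u) ^ m * exp (v\<^sup>2 / 4)) UNIV"
      using sums_mult[OF y, of "K * (v / norm u) ^ m"] K v
      by (intro sums_nonneg_imp_has_sum) (auto simp: y_def)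
    then show "((\<lambda>s. majorant (m, s)) has_sum K * (v / norm u) ^ m * exp (v\<^sup>2 / 4)) UNIV"
      by (simp add: majorant_def)
  next
    have "summable (\<lambda>m. K * (v / norm u) ^ m * exp (v\<^sup>2 / 4))"
      using v u by (intro summable_mult summable_mult2 summable_geometric) simp
    then show "(\<lambda>m. K * (v / norm u) ^ m * exp (v\<^sup>2 / 4)) summable_on UNIV"
      using K v by (subst summable_on_UNIV_nonneg_real_iff) auto
  qed (use K v in \<open>auto simp: majorant_def y_def\<close>)
  then have maj: "(\<lambda>p. norm (majorant p)) summable_on UNIV"
    using K v by (simp add: majorant_def y_def case_prod_unfold abs_mult)
  define f where "f = (\<lambda>(i, j). graf_coeff a b i j * hankel1 (int j - int i) u)"
  have upper: "norm (f (s, s + m)) \<le> norm (majorant (m, s))" for s m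
  proof -
    have "norm (f (s, s + m)) = norm ((- a / 2) ^ s) * norm ((b / 2) ^ (s + m)) / (fact s * fact (s + m)) * norm (hankel1 (int m) u)"
      by (simp add: f_def graf_coeff_def norm_mult norm_divide)
    also have "\<dots> \<le> (v / 2) ^ s * (v / 2) ^ (s + m) / (fact s * fact (s + m)) * norm (hankel1 (int m) u)"
      using v by (intro mult_right_mono divide_right_mono mult_mono half) auto
    finally show ?thesis using diag[of s m] by (simp add: majorant_def)
  qed
  have lower: "norm (f (s + m, s)) \<le> norm (majorant (m, s))" for s m
  proof -
    have "norm (hankel1 (- int m) u) = norm (hankel1 (int m) u)"
      by (simp add: hankel1_uminus norm_mult norm_power)
    then have "norm (f (s + m, s)) = norm ((- a / 2) ^ (s + m)) * norm ((b / 2) ^ s) / (fact (s + m) * fact s) * norm (hankel1 (int m) u)"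
      by (simp add: f_def graf_coeff_def norm_mult norm_divide)
    also have "\<dots> \<le> (v / 2) ^ (s + m) * (v / 2) ^ s / (fact (s + m) * fact s) * norm (hankel1 (int m) u)"
      using v by (intro mult_right_mono divide_right_mono mult_mono half) auto
    also have "\<dots> = (v / 2) ^ s * (v / 2) ^ (s + m) / (fact s * fact (s + m)) * norm (hankel1 (int m) u)"
      by (simp only: mult.commute)
    finally show ?thesis using diag[of s m] by (simp add: majorant_def)
  qed
  have pull: "f summable_on X" if "bij_betw h (UNIV \<times> UNIV) X" "\<And>m s. norm (f (h (m, s))) \<le> norm (majorant (m, s))"
    for X and h :: "nat \<times> nat \<Rightarrow> nat \<times> nat"
  proof -
    have "(\<lambda>p. norm (f (h p))) summable_on UNIV"
      by (rule Infinite_Sum.abs_summable_on_comparison_test[OF maj]) (use that(2) in \<open>simp add: split_paired_all\<close>)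
    then have "(\<lambda>p. f (h p)) summable_on UNIV" by (rule abs_summable_summable)
    then show ?thesis using summable_on_reindex_bij_betw[OF that(1), of f] unfolding UNIV_Times_UNIV by blast
  qed
  have "f summable_on {(i, j). i \<le> j}"
  proof (rule pull)
    show "bij_betw (\<lambda>(m, s). (s, s + m)) (UNIV \<times> UNIV) {(i, j :: nat). i \<le> j}"
      by (rule bij_betwI[where g = "\<lambda>(i, j). (j - i, i)"]) auto
  qed (use upper in simp)
  moreover have "f summable_on {(i, j). j \<le> i}"
  proof (rule pull)
    show "bij_betw (\<lambda>(m, s). (s + m, s)) (UNIV \<times> UNIV) {(i, j :: nat). j \<le> i}"
      by (rule bij_betwI[where g = "\<lambda>(i, j). (i - j, j)"]) auto
  qed (use lower in simp)
  moreover have "{(i, j). i \<le> j} \<union> {(i, j). j \<le> i} = (UNIV :: (nat \<times> nat) set)" by auto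
  ultimately show ?thesis
    using summable_on_union[of f "{(i, j). i \<le> j}" "{(i, j). j \<le> i}"] unfolding f_def by simp
qed

theorem graf_addition:
  assumes "norm a < norm u" "norm b < norm u"
  shows "graf_term u a b sums graf_path u a b 0 1"
proof -
  define g where "g i j = graf_coeff a b i j * hankel1 (int j - int i) u" for i j
  have summable: "(\<lambda>(i, j). g i j) summable_on UNIV"
    using graf_series_summable[OF assms] by (simp add: g_def)
  have antidiagonals: "(\<lambda>n. \<Sum>i\<le>n. g i (n - i)) sums graf_path u a b 0 1"
  proof -
    have "int (n - i) - int i = int n - 2 * int i" if "i \<le> n" for n i using that by simp
    then show ?thesis using graf_taylor[OF assms] by (simp add: g_def)
  qed
  have upper: "(\<lambda>s. g s (s + m)) sums (hankel1 (int m) u * polar_J m b a)" for m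
    using sums_mult[OF graf_coeff_diagonal_sums(1)[of a b m], of "hankel1 (int m) u"]
    by (simp add: g_def mult.commute)
  have lower: "(\<lambda>s. g (s + Suc m) s) sums (hankel1 (int (Suc m)) u * polar_J (Suc m) a b)" for m
  proof -
    have sign: "x * ((- 1) ^ m * y) * ((- 1) ^ m * z) = x * (y * z)" for m and x y z :: complex
      by (cases "even m") simp_all
    have "int s - int (s + Suc m) = - int (Suc m)" for s by simp
    then have "g (s + Suc m) s = graf_coeff a b (s + Suc m) s * ((- 1) ^ Suc m * hankel1 (int (Suc m)) u)" for s
      unfolding g_def by (simp only: hankel1_uminus)
    moreover have "(- 1) ^ Suc m * polar_J (Suc m) a b * ((- 1) ^ Suc m * hankel1 (int (Suc m)) u)
        = hankel1 (int (Suc m)) u * polar_J (Suc m) a b"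
      using sign[of 1 "Suc m" "polar_J (Suc m) a b" "hankel1 (int (Suc m)) u"] by (simp only: mult_1_left mult.commute)
    ultimately show ?thesis
      using sums_mult2[OF graf_coeff_diagonal_sums(2)[of a b "Suc m"], of "(- 1) ^ Suc m * hankel1 (int (Suc m)) u"]
      by (simp only:)
  qed
  obtain S1 S2 where S: "(\<lambda>m. hankel1 (int m) u * polar_J m b a) sums S1"
    "(\<lambda>m. hankel1 (int (Suc m)) u * polar_J (Suc m) a b) sums S2" "graf_path u a b 0 1 = S1 + S2"
    using sums_antidiagonals_eq_diagonals[OF summable antidiagonals upper lower] by blast
  define V where "V m = (if m = 0 then 0 else hankel1 (int m) u * polar_J m a b)" for m
  have "V sums S2"
    using S(2) sums_Suc_iff[of V S2] by (simp add: V_def)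
  from sums_add[OF S(1) this] show ?thesis
    unfolding S(3) by (rule back_subst[of "\<lambda>f. f sums (S1 + S2)"]) (auto simp: V_def graf_term_def distrib_left)
qed

section \<open>Sources and observers in the plane\<close>

lemma bessel_J_of_nat: "bessel_J (int n) z = (z / 2) ^ n * reduced_J n (z * z)"
  by (simp add: bessel_J_def bessel_J_nat_eq)

lemma bessel_J_uminus: "bessel_J (- int n) z = (- 1) ^ n * bessel_J (int n) z"
  by (cases n) (simp_all add: bessel_J_def del: of_nat_Suc)

lemma bessel_J_times_cis:
  assumes "c * c' = 1"
  shows "bessel_J (int n) z * c ^ n = polar_J n (z * c) (z * c')"
proof -
  have "z * c * (z * c') = z * z * (c * c')" by (simp add: mult_ac)
  also have "\<dots> = z * z" using assms by simp
  finally have "z * c * (z * c') = z * z" .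
  then have "polar_J n (z * c) (z * c') = (z * c / 2) ^ n * reduced_J n (z * z)"
    by (simp only: polar_J_def)
  also have "(z * c / 2) ^ n = (z / 2) ^ n * c ^ n"
    unfolding power_mult_distrib[symmetric] by simp
  finally show ?thesis unfolding bessel_J_of_nat by (simp only: mult_ac)
qed

lemma polar_J_0_commute: "polar_J 0 A B = polar_J 0 B A"
  by (simp add: polar_J_def mult.commute)

lemma sum_symmetric_int_interval:
  fixes F :: "int \<Rightarrow> 'a::comm_monoid_add"
  shows "(\<Sum>m = - int M..int M. F m) = (\<Sum>n\<le>M. F (int n) + (if n = 0 then 0 else F (- int n)))"
proof (induction M)
  case (Suc M)
  have "{- int (Suc M)..int (Suc M)} = insert (int (Suc M)) (insert (- int (Suc M)) {- int M..int M})"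
    by auto
  then have "(\<Sum>m = - int (Suc M)..int (Suc M). F m)
      = F (int (Suc M)) + (F (- int (Suc M)) + (\<Sum>m = - int M..int M. F m))"
    by simp
  then show ?case unfolding Suc by (simp add: ac_simps)
qed simp

definition cplx :: "real^2 \<Rightarrow> complex" where
  "cplx v = Complex (v $ 1) (v $ 2)"

lemma cplx_add: "cplx (v + w) = cplx v + cplx w"
  and cplx_diff: "cplx (v - w) = cplx v - cplx w"
  and cplx_scaleR: "cplx (t *\<^sub>R v) = of_real t * cplx v"
  by (simp_all add: cplx_def complex_eq_iff)

lemma norm_cplx [simp]: "norm (cplx v) = norm v"
  by (simp add: cplx_def cmod_def norm_vec_def L2_set_def UNIV_2)

lemma cplx_polar: "cplx v = of_real (norm v) * cis (angle2 v)"
  using Arg2pi_eq[of "cplx v"] by (simp add: angle2_def cplx_def[symmetric] cis_conv_exp)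

text \<open>
  These are the arguments of the addition theorem for the wavenumber \<open>k\<close>, the expansion centre \<open>x\<^sub>j\<close> and
  the observer \<open>x\<close>. The rotation by the angle of \<open>x - x\<^sub>j\<close> places the observer at angle zero.
  Both \<open>graf_a\<close> and \<open>graf_b\<close> are real-linear in \<open>v\<close>. The terms of the expansion are analytic in them,
  hence smooth at the centre \<open>v = 0\<close> although polar coordinates are singular there.
\<close>

context
  fixes k :: complex and xj x :: "real^2"
begin

definition graf_u :: complex where "graf_u = k * of_real (norm (x - xj))"
definition graf_a :: "real^2 \<Rightarrow> complex" where
  "graf_a v = k * cis (angle2 (x - xj)) * cnj (cplx v)"
definition graf_b :: "real^2 \<Rightarrow> complex" where
  "graf_b v = k * cis (- angle2 (x - xj)) * cplx v"

lemma norm_graf_u: "norm graf_u = norm k * norm (x - xj)"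
  and norm_graf_a: "norm (graf_a v) = norm k * norm v"
  and norm_graf_b: "norm (graf_b v) = norm k * norm v"
  by (simp_all add: graf_u_def graf_a_def graf_b_def norm_mult)

lemma graf_a_add: "graf_a (v + t *\<^sub>R w) = graf_a v + of_real t * graf_a w"
  and graf_b_add: "graf_b (v + t *\<^sub>R w) = graf_b v + of_real t * graf_b w"
  by (simp_all add: graf_a_def graf_b_def cplx_add cplx_scaleR algebra_simps)

lemma graf_trunc_eq: "graf_trunc k M xj x y = \<i> / 4 * (\<Sum>m\<le>M. graf_term graf_u (graf_a (y - xj)) (graf_b (y - xj)) m)"
proof -
  define \<theta> where "\<theta> = angle2 (x - xj) - angle2 (y - xj)"
  define z where "z = k * of_real (norm (y - xj))"
  have a: "graf_a (y - xj) = z * cis \<theta>" and b: "graf_b (y - xj) = z * cis (- \<theta>)"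
    by (simp_all add: graf_a_def graf_b_def cplx_polar[of "y - xj"] z_def \<theta>_def cis_cnj cis_mult
        flip: cis_mult) (simp_all add: cis_mult mult_ac)
  have e: "exp (\<i> * of_int (int n) * of_real \<theta>) = cis \<theta> ^ n" for n
    by (simp add: cis_conv_exp mult_ac flip: exp_of_nat_mult)
  have e': "exp (\<i> * of_int (- int n) * of_real \<theta>) = cis (- \<theta>) ^ n" for n
    by (simp add: cis_conv_exp mult_ac flip: exp_of_nat_mult)
  have c: "cis \<theta> * cis (- \<theta>) = 1" "cis (- \<theta>) * cis \<theta> = 1" by (simp_all add: cis_mult)
  define F where "F m = hankel1 m graf_u * bessel_J m z * exp (\<i> * of_int m * of_real \<theta>)" for m
  have pos: "F (int n) = hankel1 (int n) graf_u * polar_J n (graf_a (y - xj)) (graf_b (y - xj))" for n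
    unfolding F_def e a b by (simp add: bessel_J_times_cis[OF c(1)] mult.assoc)
  have neg: "F (- int n) = hankel1 (int n) graf_u * polar_J n (graf_b (y - xj)) (graf_a (y - xj))" for n
  proof -
    have sign: "s * h * (s * j) * q = h * (j * q)" if "s * s = 1" for s h j q :: complex
    proof -
      have "s * h * (s * j) * q = s * s * (h * (j * q))" by (simp only: mult_ac)
      then show ?thesis using that by simp
    qed
    show ?thesis
      unfolding F_def e' a b hankel1_uminus bessel_J_uminus
      by (subst sign) (simp_all add: bessel_J_times_cis[OF c(2)] flip: power_mult_distrib)
  qed
  have "F (int n) + (if n = 0 then 0 else F (- int n)) = graf_term graf_u (graf_a (y - xj)) (graf_b (y - xj)) n" for n
    unfolding pos neg graf_term_def
    using polar_J_0_commute[of "graf_a (y - xj)" "graf_b (y - xj)"] by (simp add: algebra_simps)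
  moreover have "graf_trunc k M xj x y = \<i> / 4 * (\<Sum>m = - int M..int M. F m)"
    by (simp only: graf_trunc_def F_def graf_u_def z_def \<theta>_def)
  ultimately show ?thesis unfolding sum_symmetric_int_interval by simp
qed

text \<open>
  Since the Hankel function of order zero depends on \<open>A\<close> and \<open>B\<close> only through \<open>A B\<close> and the
  logarithm, it suffices to compare these two. With \<open>\<zeta> = b/u\<close> and \<open>a/u\<close> its conjugate,
  \<open>A B = u\<^sup>2 |1 - \<zeta>|\<^sup>2\<close> and the two correction logarithms add up to \<open>2 ln |1 - \<zeta>|\<close>, where
  \<open>|1 - \<zeta>| = |x - y| / |x - x\<^sub>j|\<close>. Both sides of the logarithm identity contain the same \<open>Ln (k/2)\<close>,
  which keeps everything on the principal branch.
\<close>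

lemma green_eq:
  assumes k: "k \<noteq> 0" and y: "norm (y - xj) < norm (x - xj)"
  shows "green k (x - y) = \<i> / 4 * graf_path graf_u (graf_a (y - xj)) (graf_b (y - xj)) 0 1"
proof -
  define r s where "r = norm (x - xj)" and "s = norm (x - y)"
  define \<alpha> where "\<alpha> = angle2 (x - xj)"
  define \<zeta> where "\<zeta> = cis (- \<alpha>) * cplx (y - xj) / of_real r"
  have r: "0 < r" using y norm_ge_zero[of "y - xj"] unfolding r_def by linarith
  have s: "0 < s" using y by (auto simp: s_def)
  have "norm \<zeta> < 1" using y r by (simp add: \<zeta>_def norm_mult norm_divide r_def)
  then have "Re \<zeta> < 1" using complex_Re_le_cmod order_le_less_trans by blast
  then have \<zeta>: "1 - \<zeta> \<notin> \<real>\<^sub>\<le>\<^sub>0" "1 - \<zeta> \<noteq> 0" by (auto simp: complex_nonpos_Reals_iff)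
  have cis_cancel: "cis \<alpha> * cis (- \<alpha>) = 1" by (simp add: cis_mult)
  have a: "graf_a (y - xj) = graf_u * cnj \<zeta>" and b: "graf_b (y - xj) = graf_u * \<zeta>"
    using r by (simp_all add: graf_a_def graf_b_def graf_u_def \<zeta>_def \<alpha>_def r_def cis_cnj)
  have ratio: "norm (1 - \<zeta>) = s / r"
  proof -
    have "cplx (x - y) = cplx (x - xj) - cplx (y - xj)"
      unfolding cplx_diff[symmetric] by simp
    also have "\<dots> = of_real r * cis \<alpha> * (1 - \<zeta>)"
    proof -
      have "of_real r * cis \<alpha> * \<zeta> = cis \<alpha> * cis (- \<alpha>) * cplx (y - xj)"
        using r by (simp add: \<zeta>_def)
      then have "of_real r * cis \<alpha> * \<zeta> = cplx (y - xj)" unfolding cis_cancel by simp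
      moreover have "cplx (x - xj) = of_real r * cis \<alpha>"
        unfolding r_def \<alpha>_def by (rule cplx_polar)
      ultimately show ?thesis by (simp only: right_diff_distrib mult_1_right)
    qed
    finally have "norm (cplx (x - y)) = r * norm (1 - \<zeta>)" using r by (simp add: norm_mult)
    then show ?thesis using r by (simp add: s_def field_simps)
  qed
  have u: "graf_u \<noteq> 0" using k r by (simp add: graf_u_def r_def)
  have AB: "(graf_u - graf_a (y - xj)) * (graf_u - graf_b (y - xj)) = (k * of_real s) * (k * of_real s)"
  proof -
    have "(graf_u - graf_a (y - xj)) * (graf_u - graf_b (y - xj)) = graf_u * graf_u * ((1 - \<zeta>) * cnj (1 - \<zeta>))"
      unfolding a b by (simp add: algebra_simps)
    also have "\<dots> = graf_u * graf_u * of_real ((s / r)\<^sup>2)"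
      unfolding complex_norm_square[symmetric] ratio by simp
    also have "\<dots> = (k * of_real s) * (k * of_real s)"
      using r by (simp add: graf_u_def r_def[symmetric] power2_eq_square)
    finally show ?thesis .
  qed
  have "Ln (1 - 1 * graf_a (y - xj) / graf_u) + Ln (1 - 1 * graf_b (y - xj) / graf_u)
      = cnj (Ln (1 - \<zeta>)) + Ln (1 - \<zeta>)"
    using u cnj_Ln[OF \<zeta>(1)] by (simp add: a b)
  also have "\<dots> = of_real (2 * ln (s / r))"
    using \<zeta>(2) by (simp add: complex_eq_iff ratio)
  also have "\<dots> = 2 * (of_real (ln s) - of_real (ln r))"
    using r s by (simp add: ln_div)
  finally have logs: "2 * Ln (graf_u / 2) + Ln (1 - 1 * graf_a (y - xj) / graf_u)
      + Ln (1 - 1 * graf_b (y - xj) / graf_u) = 2 * Ln (k * of_real s / 2)"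
  proof -
    have Ln_scale: "Ln (k * of_real t / 2) = of_real (ln t) + Ln (k / 2)" if "0 < t" for t
      using Ln_times_of_real[OF that, of "k / 2"] Ln_of_real[OF that] k by (simp add: mult_ac)
    assume "Ln (1 - 1 * graf_a (y - xj) / graf_u) + Ln (1 - 1 * graf_b (y - xj) / graf_u)
      = 2 * (of_real (ln s) - of_real (ln r))"
    then show ?thesis
      using Ln_scale[OF r] Ln_scale[OF s] by (simp add: graf_u_def r_def[symmetric] add.assoc algebra_simps)
  qed
  have "k * of_real s \<noteq> 0" using k s by simp
  from hankel1_eq_polar_hankel[OF this, of 0]
  have "hankel1 0 (k * of_real s) = graf_path graf_u (graf_a (y - xj)) (graf_b (y - xj)) 0 1"
    unfolding graf_path_def logs
    by (simp add: polar_hankel_def polar_hankel_nat_def polar_J_def polar_Y_def polar_pole_def AB)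
  then show ?thesis by (simp add: green_def s_def)
qed

lemma graf_remainder:
  assumes k: "k \<noteq> 0" and y: "norm (y - xj) < norm (x - xj)"
  shows "(\<lambda>n. \<i> / 4 * graf_term graf_u (graf_a (y - xj)) (graf_b (y - xj)) (n + Suc M)) sums
     (green k (x - y) - graf_trunc k M xj x y)"
proof -
  have "norm (graf_a (y - xj)) < norm graf_u" "norm (graf_b (y - xj)) < norm graf_u"
    using k y by (simp_all add: norm_graf_a norm_graf_b norm_graf_u)
  from sums_mult[OF sums_split_initial_segment[OF graf_addition[OF this], of "Suc M"], of "\<i> / 4"]
  show ?thesis
    unfolding green_eq[OF assms] graf_trunc_eq by (simp add: right_diff_distrib lessThan_Suc_atMost del: sum.lessThan_Suc)
qed

end

section \<open>Error estimates\<close>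

lemma hankel_const_nonneg: "0 \<le> \<Lambda> \<Longrightarrow> 0 \<le> hankel_const R \<Lambda>"
  by (simp add: hankel_const_def)

definition graf_term_deriv :: "complex \<Rightarrow> complex \<Rightarrow> complex \<Rightarrow> complex \<Rightarrow> complex \<Rightarrow> nat \<Rightarrow> complex" where
  "graf_term_deriv u a b a' b' n = hankel1 (int (Suc n)) u *
     ((b' / 2 * polar_J n b a - a' / 2 * polar_J (Suc (Suc n)) b a)
      + (a' / 2 * polar_J n a b - b' / 2 * polar_J (Suc (Suc n)) a b))"

lemma graf_term_Suc:
  "graf_term u a b (Suc n) = hankel1 (int (Suc n)) u * (polar_J (Suc n) b a + polar_J (Suc n) a b)"
  by (simp add: graf_term_def del: of_nat_Suc)

lemma has_field_derivative_graf_term: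
  "((\<lambda>t. graf_term u (a + t * a') (b + t * b') (Suc n)) has_field_derivative
     graf_term_deriv u (a + t * a') (b + t * b') a' b' n) (at t within S)"
proof -
  have d: "((\<lambda>t. c + t * c') has_field_derivative c') (at t)" for c c' :: complex
    by (auto intro!: derivative_eq_intros)
  have "((\<lambda>t. graf_term u (a + t * a') (b + t * b') (Suc n)) has_field_derivative
     graf_term_deriv u (a + t * a') (b + t * b') a' b' n) (at t)"
    unfolding graf_term_Suc graf_term_deriv_def
    by (intro DERIV_cmult DERIV_add has_field_derivative_polar_J_Suc d)
  then show ?thesis by (rule has_field_derivative_at_within)
qed

context
  fixes u a b :: complex and R \<Lambda> v :: real
  assumes u: "u \<noteq> 0" "norm u \<le> R" "norm (Ln (u / 2)) \<le> \<Lambda>"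
    and v: "norm a \<le> v" "norm b \<le> v" "v \<le> R"
begin

lemma v_nonneg: "0 \<le> v" and \<Lambda>_nonneg: "0 \<le> \<Lambda>"
  using u v norm_ge_zero order_trans by blast+

lemma exp_v_le: "exp (v\<^sup>2 / 4) \<le> exp (R\<^sup>2 / 4)"
  using v v_nonneg by (simp add: power_mono)

lemma norm_polar_J_le_R:
  assumes "norm A \<le> v" "norm B \<le> v"
  shows "norm (polar_J n A B) \<le> (v / 2) ^ n / fact n * exp (R\<^sup>2 / 4)"
  using norm_polar_J_le[OF assms, of n]
  by (rule order_trans) (use v_nonneg in \<open>intro mult_left_mono exp_v_le; simp\<close>)

lemma hankel_scale:
  "hankel_const R \<Lambda> * fact n / (norm u / 2) ^ Suc n * ((v / 2) ^ Suc n / fact (Suc n))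
    = hankel_const R \<Lambda> * ((v / norm u) ^ Suc n / real (Suc n))"
  "hankel_const R \<Lambda> * fact n / (norm u / 2) ^ Suc n * ((v / 2) ^ n / fact n)
    = hankel_const R \<Lambda> * ((v / norm u) ^ n * (2 / norm u))"
proof -
  have p: "(norm u / 2) ^ m \<noteq> 0" for m using u by simp
  have q: "(v / norm u) ^ m = (v / 2) ^ m / (norm u / 2) ^ m" for m
    unfolding power_divide[symmetric] by simp
  have 1: "C * f / W * (V / (N * f)) = C * (V / W / N)" if "f \<noteq> 0" for C f W V N :: real
    using that by simp
  have 2: "C * f / (w * W) * (V / f) = C * (V / W * (1 / w))" if "f \<noteq> 0" for C f W V w :: real
    using that by (simp add: mult_ac)
  show "hankel_const R \<Lambda> * fact n / (norm u / 2) ^ Suc n * ((v / 2) ^ Suc n / fact (Suc n))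
    = hankel_const R \<Lambda> * ((v / norm u) ^ Suc n / real (Suc n))"
    unfolding q fact_Suc of_nat_mult by (rule 1) simp
  have "1 / (norm u / 2) = 2 / norm u" by simp
  with 2[OF fact_nonzero, of "hankel_const R \<Lambda>" n "norm u / 2" "(norm u / 2) ^ n" "(v / 2) ^ n"]
  show "hankel_const R \<Lambda> * fact n / (norm u / 2) ^ Suc n * ((v / 2) ^ n / fact n)
    = hankel_const R \<Lambda> * ((v / norm u) ^ n * (2 / norm u))"
    unfolding q power_Suc by (simp only:)
qed

lemma norm_graf_term_le:
  "norm (graf_term u a b (Suc n))
     \<le> 2 * hankel_const R \<Lambda> * exp (R\<^sup>2 / 4) * ((v / norm u) ^ Suc n / real (Suc n))"
proof -
  define E p where "E = exp (R\<^sup>2 / 4)" and "p = (v / 2) ^ Suc n / fact (Suc n)"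
  have "norm (polar_J (Suc n) b a + polar_J (Suc n) a b) \<le> p * E + p * E"
    unfolding p_def E_def by (intro norm_triangle_mono norm_polar_J_le_R v)
  then have "norm (graf_term u a b (Suc n))
      \<le> hankel_const R \<Lambda> * fact n / (norm u / 2) ^ Suc n * (p * E + p * E)"
    unfolding graf_term_Suc norm_mult using hankel_const_nonneg[OF \<Lambda>_nonneg, of R]
    by (intro mult_mono norm_hankel1_le u) auto
  also have "\<dots> = 2 * E * (hankel_const R \<Lambda> * fact n / (norm u / 2) ^ Suc n * p)"
    by (simp only: mult_2 distrib_right distrib_left mult_ac)
  also have "\<dots> = 2 * hankel_const R \<Lambda> * E * ((v / norm u) ^ Suc n / real (Suc n))"
    unfolding p_def hankel_scale by (simp only: mult_ac)
  finally show ?thesis unfolding E_def .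
qed

text \<open>
  By the ladder relations a derivative shifts the order of the Bessel factors down or up by one. The
  downward shift dominates, and it removes the denominator \<open>n + 1\<close> and one power of \<open>v\<close> from the bound
  for the term itself.
\<close>

lemma norm_graf_term_deriv_le:
  assumes "norm a' \<le> \<kappa>" "norm b' \<le> \<kappa>"
  shows "norm (graf_term_deriv u a b a' b' n)
     \<le> hankel_const R \<Lambda> * exp (R\<^sup>2 / 4) * (1 + R\<^sup>2 / 4) * ((2 * \<kappa> / norm u) * (v / norm u) ^ n)"
proof -
  define E p where "E = exp (R\<^sup>2 / 4)" and "p = (v / 2) ^ n / fact n"
  have \<kappa>: "0 \<le> \<kappa>" using assms(1) norm_ge_zero order_trans by blast
  have p: "0 \<le> p" "0 \<le> E" using v_nonneg by (auto simp: p_def E_def)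
  have J: "norm (polar_J n A B) \<le> p * E" if "norm A \<le> v" "norm B \<le> v" for A B
    unfolding p_def E_def by (rule norm_polar_J_le_R[OF that])
  have J2: "norm (polar_J (Suc (Suc n)) A B) \<le> p * (R\<^sup>2 / 4) * E" if "norm A \<le> v" "norm B \<le> v" for A B
  proof -
    have "(v / 2) ^ Suc (Suc n) = (v / 2) ^ n * (v\<^sup>2 / 4)" by (simp add: power2_eq_square)
    also have "\<dots> / fact (Suc (Suc n)) \<le> (v / 2) ^ n * (R\<^sup>2 / 4) / fact n"
      using v v_nonneg by (intro frac_le mult_left_mono fact_mono divide_right_mono power_mono) auto
    finally have "(v / 2) ^ Suc (Suc n) / fact (Suc (Suc n)) \<le> p * (R\<^sup>2 / 4)" by (simp add: p_def)
    then have "(v / 2) ^ Suc (Suc n) / fact (Suc (Suc n)) * E \<le> p * (R\<^sup>2 / 4) * E"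
      using p by (intro mult_right_mono)
    with norm_polar_J_le_R[OF that, of "Suc (Suc n)"] show ?thesis unfolding E_def by (rule order_trans)
  qed
  have half: "norm (c / 2 * J) \<le> \<kappa> / 2 * j" if "norm c \<le> \<kappa>" "norm J \<le> j" for c J :: complex and j
    unfolding norm_mult using that \<kappa> by (intro mult_mono) (auto simp: norm_divide)
  have "norm ((b' / 2 * polar_J n b a - a' / 2 * polar_J (Suc (Suc n)) b a)
      + (a' / 2 * polar_J n a b - b' / 2 * polar_J (Suc (Suc n)) a b))
    \<le> (\<kappa> / 2 * (p * E) + \<kappa> / 2 * (p * (R\<^sup>2 / 4) * E)) + (\<kappa> / 2 * (p * E) + \<kappa> / 2 * (p * (R\<^sup>2 / 4) * E))"
    by (intro norm_triangle_mono order_trans[OF norm_triangle_ineq4] add_mono half J J2 assms v)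
  also have "\<dots> = \<kappa> * E * (1 + R\<^sup>2 / 4) * p"
    by (simp add: field_simps)
  finally have "norm (graf_term_deriv u a b a' b' n)
      \<le> hankel_const R \<Lambda> * fact n / (norm u / 2) ^ Suc n * (\<kappa> * E * (1 + R\<^sup>2 / 4) * p)"
    unfolding graf_term_deriv_def norm_mult using hankel_const_nonneg[OF \<Lambda>_nonneg, of R]
    by (intro mult_mono norm_hankel1_le u) auto
  also have "\<dots> = \<kappa> * E * (1 + R\<^sup>2 / 4) * (hankel_const R \<Lambda> * fact n / (norm u / 2) ^ Suc n * p)"
    by (simp only: mult_ac)
  also have "\<dots> = \<kappa> * E * (1 + R\<^sup>2 / 4) * (hankel_const R \<Lambda> * ((v / norm u) ^ n * (2 / norm u)))"
    unfolding p_def hankel_scale ..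
  finally show ?thesis unfolding E_def by (simp add: mult_ac)
qed

end

lemma log_series_tail:
  fixes a :: real
  assumes "\<bar>a\<bar> < 1"
  shows "(\<lambda>n. a ^ (n + Suc M) / real (n + Suc M)) sums (- ln (1 - a) - (\<Sum>m = 1..M. a ^ m / real m))"
proof -
  have "(\<lambda>n. - (- ((- (- a)) ^ n) / of_nat n)) sums - ln (1 + - a)"
    using assms by (intro sums_minus ln_series') simp
  \<comment> \<open>the term with index \<open>0\<close> is \<open>1 / 0 = 0\<close>\<close>
  then have "(\<lambda>n. a ^ n / real n) sums - ln (1 - a)" by simp
  from sums_split_initial_segment[OF this, of "Suc M"]
  have "(\<lambda>n. a ^ (n + Suc M) / real (n + Suc M)) sums (- ln (1 - a) - (\<Sum>m<Suc M. a ^ m / real m))" .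
  moreover have "(\<Sum>m<Suc M. a ^ m / real m) = (\<Sum>m = 1..M. a ^ m / real m)"
  proof -
    have "{..<Suc M} = insert 0 {1..M}" by auto
    then show ?thesis by simp
  qed
  ultimately show ?thesis by (simp only:)
qed

lemma geometric_tail:
  fixes a :: real
  assumes "\<bar>a\<bar> < 1"
  shows "(\<lambda>n. a ^ (n + N)) sums (a ^ N / (1 - a))"
  using sums_mult[OF geometric_sums[of a], of "a ^ N"] assms by (simp add: power_add mult.commute)

context
  fixes k :: complex and xj x :: "real^2" and R \<Lambda> :: real
  assumes k: "k \<noteq> 0"
    and R: "norm k * norm (x - xj) \<le> R"
    and \<Lambda>: "norm (Ln (k * of_real (norm (x - xj)) / 2)) \<le> \<Lambda>"
begin

lemma monopole_error_le:
  assumes y: "norm (y - xj) \<le> d" and d: "d < norm (x - xj)"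
  shows "monopole_error k M xj x y \<le> hankel_const R \<Lambda> * exp (R\<^sup>2 / 4) / 2 *
     (- ln (1 - d / norm (x - xj)) - (\<Sum>m = 1..M. (d / norm (x - xj)) ^ m / real m))"
proof -
  define u where "u = graf_u k xj x"
  have d0: "0 \<le> d" using y norm_ge_zero order_trans by blast
  have r: "0 < norm (x - xj)" using d d0 by linarith
  have nu: "norm u = norm k * norm (x - xj)" by (simp add: u_def norm_graf_u)
  have u: "u \<noteq> 0" "norm u \<le> R" "norm (Ln (u / 2)) \<le> \<Lambda>"
    using k r R \<Lambda> by (auto simp: u_def graf_u_def norm_mult)
  define v where "v = norm k * d"
  have v: "norm (graf_a k xj x (y - xj)) \<le> v" "norm (graf_b k xj x (y - xj)) \<le> v" "v \<le> R"
  proof -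
    show "norm (graf_a k xj x (y - xj)) \<le> v" "norm (graf_b k xj x (y - xj)) \<le> v"
      using y by (simp_all add: norm_graf_a norm_graf_b v_def mult_left_mono)
    have "v \<le> norm u" unfolding v_def nu using d by (intro mult_left_mono) auto
    then show "v \<le> R" using u by linarith
  qed
  have ratio: "v / norm u = d / norm (x - xj)" using k by (simp add: v_def nu)
  have a: "\<bar>d / norm (x - xj)\<bar> < 1" using d d0 r by simp
  show ?thesis
    unfolding monopole_error_def
  proof (rule norm_sums_le[OF graf_remainder[OF k] sums_mult[OF log_series_tail[OF a]]])
    show "norm (y - xj) < norm (x - xj)" using y d by linarith
    fix n
    show "norm (\<i> / 4 * graf_term (graf_u k xj x) (graf_a k xj x (y - xj)) (graf_b k xj x (y - xj)) (n + Suc M))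
      \<le> hankel_const R \<Lambda> * exp (R\<^sup>2 / 4) / 2 * ((d / norm (x - xj)) ^ (n + Suc M) / real (n + Suc M))"
      using norm_graf_term_le[OF u v, of "n + M"] unfolding ratio u_def[symmetric]
      by (simp add: norm_mult norm_divide mult_ac del: power_Suc of_nat_Suc)
  qed
qed

text \<open>
  The tail is differentiated term by term along the complexified line \<open>y + t \<nu>\<close> with \<open>t\<close> in a small
  disc, where the bounds for the derivatives are uniform. Let \<open>r = |x - x\<^sub>j|\<close>. At \<open>t = 0\<close> the sum of the bounds is
  \<open>K/(2r) (d/r)\<^sup>M / (1 - d/r)\<close>, with \<open>K\<close> the
  constant in \<open>norm_graf_term_deriv_le\<close>; this is \<open>K/(2d)\<close> times the quotient on the right-hand side if
  \<open>d > 0\<close>. The summand \<open>1\<close> makes the constant positive also when \<open>d = 0\<close>, where \<open>K/(2d)\<close> is zero.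
\<close>

lemma dipole_error_le:
  assumes y: "norm (y - xj) \<le> d" and d: "d < norm (x - xj)" and \<nu>: "norm \<nu> = 1" and M: "2 \<le> M"
  shows "dipole_error k M xj x y \<nu> \<le> (1 + hankel_const R \<Lambda> * exp (R\<^sup>2 / 4) * (1 + R\<^sup>2 / 4) / (2 * d)) *
     ((d / norm (x - xj)) ^ (M + 1) / (1 - d / norm (x - xj)))"
proof -
  define r where "r = norm (x - xj)"
  define u where "u = graf_u k xj x"
  define K where "K = hankel_const R \<Lambda> * exp (R\<^sup>2 / 4) * (1 + R\<^sup>2 / 4)"
  define a b a' b' where "a = graf_a k xj x (y - xj)" and "b = graf_b k xj x (y - xj)"
    and "a' = graf_a k xj x \<nu>" and "b' = graf_b k xj x \<nu>"
  have d0: "0 \<le> d" using y norm_ge_zero order_trans by blast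
  have r: "0 < r" "d < r" using d d0 unfolding r_def by linarith+
  have nu: "norm u = norm k * r" by (simp add: u_def norm_graf_u r_def)
  have u: "u \<noteq> 0" "norm u \<le> R" "norm (Ln (u / 2)) \<le> \<Lambda>"
    using k r R \<Lambda> by (auto simp: u_def graf_u_def norm_mult r_def)
  have dirs: "norm a' \<le> norm k" "norm b' \<le> norm k"
    using \<nu> by (simp_all add: a'_def b'_def norm_graf_a norm_graf_b)
  \<comment> \<open>for \<open>|t| < w - d\<close> the moving source stays within distance \<open>w < r\<close> of the centre\<close>
  define w where "w = (d + r) / 2"
  have w: "d < w" "w < r" "0 \<le> w" using r d0 by (simp_all add: w_def)
  define f where "f n t = \<i> / 4 * graf_term u (a + t * a') (b + t * b') (Suc (n + M))" for n and t :: complex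
  define f' where "f' n t = \<i> / 4 * graf_term_deriv u (a + t * a') (b + t * b') a' b' (n + M)" for n and t :: complex
  have bound: "norm (f' n t) \<le> K / (2 * r) * (\<rho> / r) ^ (n + M)"
    if "norm (a + t * a') \<le> norm k * \<rho>" "norm (b + t * b') \<le> norm k * \<rho>" "\<rho> < r" for n t \<rho>
  proof -
    have "norm k * \<rho> \<le> norm u" unfolding nu using that(3) by (intro mult_left_mono) auto
    then have "norm k * \<rho> \<le> R" using u by linarith
    from norm_graf_term_deriv_le[OF u that(1,2) this dirs, of "n + M"]
    have "norm (graf_term_deriv u (a + t * a') (b + t * b') a' b' (n + M))
        \<le> K * (2 / r * (\<rho> / r) ^ (n + M))"
      using k by (simp add: K_def nu)
    then show ?thesis by (simp add: f'_def norm_mult norm_divide mult_ac)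
  qed
  have disc: "norm (a + t * a') \<le> norm k * w" "norm (b + t * b') \<le> norm k * w" if "t \<in> ball 0 (w - d)" for t
  proof -
    have "norm c + norm t * norm c' \<le> norm k * w"
      if "norm c \<le> norm k * d" "norm c' \<le> norm k" for c c' :: complex
    proof -
      have "norm c + norm t * norm c' \<le> norm k * d + (w - d) * norm k"
        using that \<open>t \<in> ball 0 (w - d)\<close> w by (intro add_mono mult_mono) auto
      then show ?thesis by (simp add: algebra_simps)
    qed
    moreover have "norm a \<le> norm k * d" "norm b \<le> norm k * d"
      using y by (simp_all add: a_def b_def norm_graf_a norm_graf_b mult_left_mono)
    ultimately have "norm a + norm t * norm a' \<le> norm k * w" "norm b + norm t * norm b' \<le> norm k * w"
      using dirs by blast+
    then show "norm (a + t * a') \<le> norm k * w" "norm (b + t * b') \<le> norm k * w"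
      using norm_triangle_ineq[of a "t * a'"] norm_triangle_ineq[of b "t * b'"] by (simp_all add: norm_mult)
  qed
  have remainder: "(\<lambda>n. f n (of_real t)) sums (green k (x - (y + t *\<^sub>R \<nu>)) - graf_trunc k M xj x (y + t *\<^sub>R \<nu>))"
    if "\<bar>t\<bar> < w - d" for t
  proof -
    have "norm (y + t *\<^sub>R \<nu> - xj) \<le> norm (y - xj) + \<bar>t\<bar>"
      using norm_triangle_ineq[of "y - xj" "t *\<^sub>R \<nu>"] \<nu> by (simp add: algebra_simps)
    then have "norm (y + t *\<^sub>R \<nu> - xj) < norm (x - xj)" using y that w unfolding r_def by linarith
    note remainder = graf_remainder[OF k this, of M]
    have shift: "y + t *\<^sub>R \<nu> - xj = (y - xj) + t *\<^sub>R \<nu>" by simp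
    show ?thesis
      using remainder unfolding f_def u_def a_def b_def a'_def b'_def shift graf_a_add graf_b_add add_Suc_right .
  qed
  have of_real_deriv: "(complex_of_real has_vector_derivative 1) (at 0)"
    using bounded_linear_imp_has_derivative[OF bounded_linear_of_real]
    by (simp add: has_vector_derivative_def scaleR_conv_of_real)
  have "((\<lambda>t. \<Sum>n. f n t) has_field_derivative (\<Sum>n. f' n 0)) (at 0)"
  proof (rule has_field_derivative_series'(2)[of "ball 0 (w - d)" f f' 0])
    show "(f n has_field_derivative f' n t) (at t within ball 0 (w - d))" for n t
      unfolding f_def f'_def by (intro DERIV_cmult has_field_derivative_graf_term)
    show "uniformly_convergent_on (ball 0 (w - d)) (\<lambda>n t. \<Sum>i<n. f' i t)"
    proof (rule Weierstrass_m_test')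
      show "norm (f' n t) \<le> K / (2 * r) * (w / r) ^ (n + M)" if "t \<in> ball 0 (w - d)" for n t
        using bound[OF disc[OF that]] w by simp
      show "summable (\<lambda>n. K / (2 * r) * (w / r) ^ (n + M))"
        using geometric_tail[of "w / r" M] w r by (intro summable_mult sums_summable) auto
    qed
    show "summable (\<lambda>n. f n 0)"
      using remainder[of 0] w by (auto simp: sums_iff)
  qed (use w in auto)
  then have "((\<lambda>t. \<Sum>n. f n (of_real t)) has_vector_derivative (\<Sum>n. f' n 0)) (at 0)"
    using field_vector_diff_chain_at[of of_real 1 0 "\<lambda>t. \<Sum>n. f n t" "\<Sum>n. f' n 0"] of_real_deriv
    by (simp add: o_def)
  then have "((\<lambda>t. green k (x - (y + t *\<^sub>R \<nu>)) - graf_trunc k M xj x (y + t *\<^sub>R \<nu>))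
      has_vector_derivative (\<Sum>n. f' n 0)) (at 0)"
  proof (rule has_vector_derivative_transform_within_open[of _ _ _ "ball 0 (w - d)"])
    show "(\<Sum>n. f n (of_real t)) = green k (x - (y + t *\<^sub>R \<nu>)) - graf_trunc k M xj x (y + t *\<^sub>R \<nu>)"
      if "t \<in> ball 0 (w - d)" for t
      using remainder[of t] that by (simp add: sums_iff)
  qed (use w in auto)
  then have "dipole_error k M xj x y \<nu> = norm (\<Sum>n. f' n 0)"
    unfolding dipole_error_def directional_derivative_def by (simp add: vector_derivative_at)
  also have "\<dots> \<le> K / (2 * r) * ((d / r) ^ M / (1 - d / r))"
  proof (rule norm_sums_le)
    have a: "\<bar>d / r\<bar> < 1" using r d0 by simp
    show tail: "(\<lambda>n. K / (2 * r) * (d / r) ^ (n + M)) sums (K / (2 * r) * ((d / r) ^ M / (1 - d / r)))"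
      by (intro sums_mult geometric_tail a)
    show le: "norm (f' n 0) \<le> K / (2 * r) * (d / r) ^ (n + M)" for n
      using y r by (intro bound) (simp_all add: a_def b_def norm_graf_a norm_graf_b mult_left_mono)
    show "(\<lambda>n. f' n 0) sums (\<Sum>n. f' n 0)"
      by (intro summable_sums summable_norm_cancel[OF summable_comparison_test'[OF sums_summable[OF tail]]])
        (use le in simp)
  qed
  also have "\<dots> \<le> (1 + K / (2 * d)) * ((d / r) ^ (M + 1) / (1 - d / r))"
  proof (cases "d = 0")
    case False
    then have d: "0 < d" using d0 by simp
    have "K / (2 * r) * ((d / r) ^ M / (1 - d / r)) = K / (2 * d) * ((d / r) ^ (M + 1) / (1 - d / r))"
      using d r by (simp add: field_simps)
    also have "\<dots> \<le> (1 + K / (2 * d)) * ((d / r) ^ (M + 1) / (1 - d / r))"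
      using d r by (intro mult_right_mono) auto
    finally show ?thesis .
  qed (use M in \<open>simp add: power_0_left\<close>)
  finally show ?thesis unfolding K_def r_def .
qed

end

text \<open>
  Compactness of \<open>X\<close> and \<open>K\<close> supplies upper bounds for \<open>|k| |x - x\<^sub>j|\<close> and for the logarithm of
  \<open>k |x - x\<^sub>j| / 2\<close>. The latter is continuous on \<open>X \<times> K\<close>, since \<open>K\<close> avoids the cut and \<open>X\<close> the centre.
\<close>

theorem theorem1:
  fixes xj :: "real^2" and X Y :: "(real^2) set" and K :: "complex set"
  assumes "compact Y"
    and "compact X" and "X \<subseteq> UNIV - D_max xj Y"
    and "compact K" and "K \<subseteq> UNIV - \<real>\<^sub>\<le>\<^sub>0"
  shows "\<exists>C1 C2 :: real. C1 > 0 \<and> C2 > 0 \<and>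
    (\<forall>M\<ge>2. \<forall>x\<in>X. \<forall>k\<in>K. \<forall>y\<in>Y.
       monopole_error k M xj x y
         \<le> C1 * (- ln (1 - dist_ratio xj Y x) - (\<Sum>m = 1..M. dist_ratio xj Y x ^ m / real m))
       \<and> (\<forall>\<nu>. norm \<nu> = 1 \<longrightarrow>
            dipole_error k M xj x y \<nu>
              \<le> C2 * (dist_ratio xj Y x ^ (M + 1) / (1 - dist_ratio xj Y x))))"
proof (cases "Y = {}")
  case True
  then show ?thesis by (intro exI[of _ 1]) simp
next
  case False
  define d where "d = max_dist xj Y"
  have d: "norm (y - xj) \<le> d" if "y \<in> Y" for y
    using max_dist_is_max(2)[OF assms(1) False] that by (simp add: d_def)
  have d0: "0 \<le> d" using False d norm_ge_zero order_trans by blast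
  have X: "d < norm (x - xj)" if "x \<in> X" for x
    using assms(3) that by (auto simp: D_max_def d_def not_le)
  have cont: "continuous_on (X \<times> K) (\<lambda>(x, k). Ln (k * of_real (norm (x - xj)) / 2))"
    unfolding case_prod_unfold
  proof (intro continuous_intros)
    fix p assume "p \<in> X \<times> K"
    then have "0 < norm (fst p - xj)" "snd p \<notin> \<real>\<^sub>\<le>\<^sub>0" using X[of "fst p"] d0 assms(5) by auto
    then show "snd p * of_real (norm (fst p - xj)) / 2 \<notin> \<real>\<^sub>\<le>\<^sub>0"
      by (auto simp: complex_nonpos_Reals_iff mult_le_0_iff)
  qed auto
  obtain \<Lambda> where \<Lambda>: "norm (Ln (k * of_real (norm (x - xj)) / 2)) \<le> \<Lambda>" if "x \<in> X" "k \<in> K" for x k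
    using compact_imp_bounded[OF compact_continuous_image[OF cont compact_Times[OF assms(2,4)]]]
    unfolding bounded_iff by fastforce
  have cont_norm: "continuous_on (X \<times> K) (\<lambda>(x, k). norm k * norm (x - xj))"
    unfolding case_prod_unfold by (intro continuous_intros)
  obtain R where R: "norm k * norm (x - xj) \<le> R" if "x \<in> X" "k \<in> K" for x k
    using compact_imp_bounded[OF compact_continuous_image[OF cont_norm compact_Times[OF assms(2,4)]]]
    unfolding bounded_iff by fastforce
  \<comment> \<open>the absolute value keeps \<open>L\<close> positive when \<open>X \<times> K\<close> is empty\<close>
  define L where "L = hankel_const R \<bar>\<Lambda>\<bar> * exp (R\<^sup>2 / 4)"
  have L: "0 < L"
    by (simp add: L_def hankel_const_def add_pos_nonneg)
  show ?thesis
  proof (rule exI[of _ "L / 2"], rule exI[of _ "1 + L * (1 + R\<^sup>2 / 4) / (2 * d)"], intro conjI allI ballI impI)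
    show "0 < L / 2" "0 < 1 + L * (1 + R\<^sup>2 / 4) / (2 * d)"
      using L d0 by (simp_all add: add_pos_nonneg)
    fix M :: nat and x k y
    assume M: "2 \<le> M" and x: "x \<in> X" and k: "k \<in> K" and y: "y \<in> Y"
    have k0: "k \<noteq> 0" using k assms(5) by auto
    have \<Lambda>': "norm (Ln (k * of_real (norm (x - xj)) / 2)) \<le> \<bar>\<Lambda>\<bar>" using \<Lambda>[OF x k] by linarith
    show "monopole_error k M xj x y
         \<le> L / 2 * (- ln (1 - dist_ratio xj Y x) - (\<Sum>m = 1..M. dist_ratio xj Y x ^ m / real m))"
      using monopole_error_le[OF k0 R[OF x k] \<Lambda>' d[OF y] X[OF x]]
      by (simp only: L_def dist_ratio_def d_def)
    show "dipole_error k M xj x y \<nu>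
       \<le> (1 + L * (1 + R\<^sup>2 / 4) / (2 * d)) * (dist_ratio xj Y x ^ (M + 1) / (1 - dist_ratio xj Y x))"
      if "norm \<nu> = 1" for \<nu>
      using dipole_error_le[OF k0 R[OF x k] \<Lambda>' d[OF y] X[OF x] that M]
      by (simp only: L_def dist_ratio_def d_def)
  qed
qed

end
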